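(* Let $(M_n)_{n\ge0}$ be a nonanalytic weight sequence. Suppose $\phi$ is analytic on $\bar\Delta$, $\phi\in D(\bar\Delta,M)$, $\phi:\bar\Delta\to\bar\Delta$ and $\phi$ has fixed points only on $\bar\Delta\setminus\Delta$. (i) If $\phi$ or $\phi_N$, for some positive integer $N$, has more than one fixed point on $\bar\Delta\setminus\Delta$, then $\phi$ does not induce an endomorphism of $D(\bar\Delta,M)$. (ii) If $\phi$ has exactly one fixed point $z_1$ on $\bar\Delta\setminus\Delta$ and $\phi'(z_1)<1$, then $\phi_N$ induces an endomorphism of $D(\bar\Delta,M)$ for all $N$ large enough.
   Context: $\Delta$ is the open unit disc in $\mathbb{C}$ and $\bar\Delta$ the closed unit disc. A self-map $\phi$ of $\bar\Delta$ is analytic on $\bar\Delta$ if it extends to an analytic function on a neighborhood of $\bar\Delta$. $\phi_N$ denotes the $N$-th iterate of $\phi$ ($N$-fold composition). (In (ii), the derivative $\phi'(z_1)$ at a fixed point on the unit circle is a real number.) A function $f:\bar\Delta\to\mathbb{C}$ is complex-differentiable at $a\in\bar\Delta$ if $f'(a)=\lim_{z\to a,\ z\in\bar\Delta}\frac{f(z)-f(a)}{z-a}$ exists; higher derivatives $f^{(n)}$ are defined by iteration, and $D^\infty(\bar\Delta)$ is the set of infinitely complex-differentiable functions on $\bar\Delta$. $\|\cdot\|_\infty$ is the sup norm over $\bar\Delta$. A weight sequence is a sequence $(M_n)_{n\ge0}$ of positive numbers with $M_0=1$ and $\binom{m+n}{n}\le\frac{M_{m+n}}{M_mM_n}$ for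 all $m,n\ge0$. It is nonanalytic if $\lim_{n\to\infty}(n!/M_n)^{1/n}=0$. Define $D(\bar\Delta,M)=\{f\in D^\infty(\bar\Delta):\|f\|_{D(\bar\Delta,M)}=\sum_{n=0}^\infty\frac{\|f^{(n)}\|_\infty}{M_n}<\infty\}$, a Banach algebra under pointwise operations. A map $\psi:\bar\Delta\to\bar\Delta$ induces an endomorphism of $D(\bar\Delta,M)$ if $f\circ\psi\in D(\bar\Delta,M)$ for all $f\in D(\bar\Delta,M)$.
   Formalization: In (ii) it is additionally assumed that no iterate φ_N (N ≥ 1) has more than one fixed point on the unit circle; without this (ii) is false and contradicts (i), since φ may have one fixed point while φ_2 has several. *)

theory Defs
  imports "HOL-Complex_Analysis.Complex_Analysis"
begin

text \<open>Functions on the closed unit disc are total functions on \<^typ>\<open>complex\<close>; no notion below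
  depends on values taken outside \<^term>\<open>cball (0::complex) 1\<close>.\<close>

definition disc_deriv :: "(complex \<Rightarrow> complex) \<Rightarrow> complex \<Rightarrow> complex" where
  "disc_deriv f a = Lim (at a within cball 0 1) (\<lambda>z. (f z - f a) / (z - a))"

definition disc_smooth :: "(complex \<Rightarrow> complex) set" where
  "disc_smooth = {f. \<forall>n. \<forall>a\<in>cball 0 1.
     (disc_deriv ^^ n) f field_differentiable (at a within cball 0 1)}"

text \<open>The real supremum is junk for unbounded functions; it is only used for iterated derivatives of
  members of \<open>disc_smooth\<close>, which are continuous on the compact disc.\<close>

definition disc_sup_norm :: "(complex \<Rightarrow> complex) \<Rightarrow> real" where
  "disc_sup_norm f = (SUP z\<in>cball 0 1. norm (f z))"

definition weight_sequence :: "(nat \<Rightarrow> real) \<Rightarrow> bool" where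
  "weight_sequence M \<longleftrightarrow> (\<forall>n. M n > 0) \<and> M 0 = 1 \<and>
     (\<forall>m n. real ((m + n) choose n) \<le> M (m + n) / (M m * M n))"

definition nonanalytic :: "(nat \<Rightarrow> real) \<Rightarrow> bool" where
  "nonanalytic M \<longleftrightarrow> (\<lambda>n. root n (fact n / M n)) \<longlonglongrightarrow> 0"

definition disc_algebra :: "(nat \<Rightarrow> real) \<Rightarrow> (complex \<Rightarrow> complex) set" where
  "disc_algebra M = {f \<in> disc_smooth.
     summable (\<lambda>n. disc_sup_norm ((disc_deriv ^^ n) f) / M n)}"

text \<open>Unlike \<open>\<phi> analytic_on cball 0 1\<close>, this does not constrain \<open>\<phi>\<close> outside the closed disc.\<close>

definition analytic_on_disc :: "(complex \<Rightarrow> complex) \<Rightarrow> bool" where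
  "analytic_on_disc \<phi> \<longleftrightarrow> (\<exists>U g. open U \<and> cball 0 1 \<subseteq> U \<and> g holomorphic_on U \<and>
     (\<forall>z\<in>cball 0 1. g z = \<phi> z))"

definition induces_endomorphism :: "(nat \<Rightarrow> real) \<Rightarrow> (complex \<Rightarrow> complex) \<Rightarrow> bool" where
  "induces_endomorphism M \<psi> \<longleftrightarrow> (\<forall>f\<in>disc_algebra M. f \<circ> \<psi> \<in> disc_algebra M)"

definition boundary_fixpoints :: "(complex \<Rightarrow> complex) \<Rightarrow> complex set" where
  "boundary_fixpoints \<psi> = {z \<in> cball 0 1 - ball 0 1. \<psi> z = z}"

text \<open>A self-map with a single fixed point can have further periodic points on the unit circle.
  For instance \<open>F w = 2 * w + 1 / (w / 3 + (w\<^sup>2 + 1) / (w + 1)\<^sup>2)\<close> on the closed right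
  half-plane, transported to the disc by the Cayley transform, fixes only the point corresponding
  to infinity (with derivative 1/2), but interchanges the points corresponding to \<open>\<i>\<close> and
  \<open>-\<i>\<close>. Iterates therefore have to be included when
  separating maps with several boundary fixed points from maps with exactly one.\<close>

definition multiple_boundary_fixpoints :: "(complex \<Rightarrow> complex) \<Rightarrow> bool" where
  "multiple_boundary_fixpoints \<psi> \<longleftrightarrow>
     (\<exists>z\<in>boundary_fixpoints \<psi>. \<exists>w\<in>boundary_fixpoints \<psi>. z \<noteq> w)"

end

theory Submission
  imports Defs
begin

text \<open>
  If an analytic self-map \<open>\<psi>\<close> has a boundary fixed point \<open>w\<close> with \<open>|\<psi>'(w)| > 1\<close>, then composition with \<open>\<psi>\<close>
  does not preserve the algebra (\<open>repelling_fixpoint_no_endomorphism\<close>). An induced endomorphism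
  would be automatically bounded, say by \<open>C\<close> (\<open>induced_endomorphism_bounded\<close>, a gliding hump
  argument); but on functions vanishing to order \<open>n\<close> at \<open>w\<close> the functional \<open>f \<mapsto> f\<^sup>(\<^sup>n\<^sup>)(w)\<close> is
  multiplied by \<open>\<psi>'(w)\<^sup>n\<close>, so that \<open>|\<psi>'(w)|\<^sup>n \<le> C\<close> for all \<open>n\<close>. If, on the other hand, \<open>\<parallel>\<psi>'\<parallel> < 1\<close> on
  the closed disc, then Faa di Bruno's formula and the decay of \<open>(n! / M\<^sub>n)\<^sup>1\<^sup>/\<^sup>n\<close> show that \<open>\<psi>\<close>
  induces an endomorphism (\<open>contraction_induces_endomorphism\<close>).

  For the first half, \<open>\<phi>\<close> has no interior fixed point, so by \<open>Wolff_point\<close> there is a boundary point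
  \<open>p\<close> all of whose horodiscs are invariant under \<open>\<phi>\<close> and its iterates. At a boundary fixed point of
  \<open>\<phi>\<^sup>N\<close> other than \<open>p\<close> this invariance and the Hopf lemma give a derivative of modulus greater than
  \<open>1\<close> (\<open>iterate_repelling_boundary_fixpoint\<close>). Two boundary fixed points of \<open>\<phi>\<^sup>N\<close> therefore exclude
  an endomorphism.

  For the second half, the derivative at the fixed point \<open>p\<close> is real and nonnegative, hence of
  modulus less than \<open>1\<close>, so \<open>p\<close> attracts a neighbourhood. By Schwarz--Pick it attracts all interior
  points. An orbit that never enters the interior stays in the set \<open>|z| = |\<phi>(z)| = 1\<close>. This set is
  finite or the whole circle (\<open>unimodular_finite_or_all\<close>), and the latter would produce a second
  fixed point (\<open>inner_attracting_second_fixpoint\<close>); so the orbit is eventually periodic, and since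
  the iterates have no further boundary fixed points it ends in \<open>p\<close>. Hence every orbit reaches the
  neighbourhood of \<open>p\<close>, by compactness uniformly, and \<open>\<parallel>(\<phi>\<^sup>N)'\<parallel> \<rightarrow> 0\<close>.

  A map \<open>\<phi>\<close> that takes an interior point to the circle is constant by the maximum principle and is
  treated separately.
\<close>

section \<open>Derivatives on the closed disc\<close>

lemma at_within_cball_neq_bot:
  fixes a :: complex
  assumes "a \<in> cball 0 1"
  shows "at a within cball 0 1 \<noteq> bot"
proof -
  have "a islimpt ball 0 1" using assms by (simp add: islimpt_ball)
  hence "a islimpt cball 0 1" by (rule islimpt_subset) auto
  thus ?thesis by (simp add: trivial_limit_within)
qed

lemma disc_deriv_eqI:
  assumes "(f has_field_derivative d) (at a within cball 0 1)" "a \<in> cball 0 1"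
  shows "disc_deriv f a = d"
  using assms at_within_cball_neq_bot[OF assms(2)] unfolding disc_deriv_def has_field_derivative_iff
  by (intro tendsto_Lim)

lemma disc_smooth_has_field_derivative:
  assumes "f \<in> disc_smooth" "a \<in> cball 0 1"
  shows "((disc_deriv ^^ n) f has_field_derivative (disc_deriv ^^ Suc n) f a) (at a within cball 0 1)"
proof -
  from assms obtain d where d: "((disc_deriv ^^ n) f has_field_derivative d) (at a within cball 0 1)"
    unfolding disc_smooth_def field_differentiable_def by blast
  with disc_deriv_eqI[OF d assms(2)] show ?thesis by simp
qed

text \<open>A function is smooth on the disc as soon as it starts some sequence of successive derivatives,
  and that sequence is then the sequence of iterated derivatives.\<close>

lemma disc_smooth_sequenceI:
  assumes "\<And>z. z \<in> cball 0 1 \<Longrightarrow> f z = F 0 z"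
    and der: "\<And>n z. z \<in> cball 0 1 \<Longrightarrow> (F n has_field_derivative F (Suc n) z) (at z within cball 0 1)"
  shows "f \<in> disc_smooth" and "z \<in> cball 0 1 \<Longrightarrow> (disc_deriv ^^ n) f z = F n z"
proof -
  have *: "\<forall>z\<in>cball 0 1. (disc_deriv ^^ n) f z = F n z" for n
  proof (induction n)
    case (Suc n)
    show ?case
    proof
      fix z :: complex assume z: "z \<in> cball 0 1"
      have "((disc_deriv ^^ n) f has_field_derivative F (Suc n) z) (at z within cball 0 1)"
        by (rule has_field_derivative_transform_within[OF der[OF z], of 1]) (use Suc z in auto)
      from disc_deriv_eqI[OF this z] show "(disc_deriv ^^ Suc n) f z = F (Suc n) z" by simp
    qed
  qed (use assms in auto)
  show "f \<in> disc_smooth" unfolding disc_smooth_def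
  proof (intro CollectI allI ballI)
    fix n and z :: complex assume z: "z \<in> cball 0 1"
    have "((disc_deriv ^^ n) f has_field_derivative F (Suc n) z) (at z within cball 0 1)"
      by (rule has_field_derivative_transform_within[OF der[OF z], of 1]) (use * z in auto)
    thus "(disc_deriv ^^ n) f field_differentiable at z within cball 0 1"
      unfolding field_differentiable_def by blast
  qed
  show "z \<in> cball 0 1 \<Longrightarrow> (disc_deriv ^^ n) f z = F n z" using * by blast
qed

lemma disc_smooth_continuous:
  assumes "f \<in> disc_smooth"
  shows "continuous_on (cball 0 1) ((disc_deriv ^^ n) f)"
  using disc_smooth_has_field_derivative[OF assms]
  by (meson DERIV_continuous continuous_on_eq_continuous_within)

lemma disc_smooth_holomorphic:
  assumes "f \<in> disc_smooth"
  shows "(disc_deriv ^^ n) f holomorphic_on ball 0 1"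
proof -
  have "((disc_deriv ^^ n) f has_field_derivative (disc_deriv ^^ Suc n) f z) (at z)"
    if "z \<in> ball 0 1" for z
    using disc_smooth_has_field_derivative[OF assms, of z n] that at_within_interior[of z "cball 0 1"]
    by auto
  thus ?thesis by (meson holomorphic_on_open open_ball)
qed

lemma disc_deriv_eq_higher_deriv_interior:
  assumes "f \<in> disc_smooth" "z \<in> ball 0 1"
  shows "(disc_deriv ^^ n) f z = (deriv ^^ n) f z"
  using assms(2)
proof (induction n arbitrary: z)
  case (Suc n)
  have d: "((disc_deriv ^^ n) f has_field_derivative (disc_deriv ^^ Suc n) f z) (at z)"
    using disc_smooth_has_field_derivative[OF assms(1), of z n] Suc.prems
      at_within_interior[of z "cball 0 1"] by auto
  have "((deriv ^^ n) f has_field_derivative (disc_deriv ^^ Suc n) f z) (at z)"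
    by (rule has_field_derivative_transform_within_open[OF d, of "ball 0 1"]) (use Suc in auto)
  thus ?case by (simp add: DERIV_imp_deriv)
qed auto

lemma holomorphic_imp_disc_smooth:
  assumes "open U" "cball 0 1 \<subseteq> U" "g holomorphic_on U" "\<And>z. z \<in> cball 0 1 \<Longrightarrow> g z = f z"
  shows "f \<in> disc_smooth" and "z \<in> cball 0 1 \<Longrightarrow> (disc_deriv ^^ n) f z = (deriv ^^ n) g z"
proof -
  have *: "((deriv ^^ n) g has_field_derivative (deriv ^^ Suc n) g z) (at z within cball 0 1)"
    if "z \<in> cball 0 1" for n z
  proof -
    have "(deriv ^^ n) g holomorphic_on U" using assms by (simp add: holomorphic_higher_deriv)
    with that assms have "((deriv ^^ n) g has_field_derivative deriv ((deriv ^^ n) g) z) (at z)"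
      by (meson holomorphic_derivI subsetD)
    thus ?thesis by (simp add: has_field_derivative_at_within)
  qed
  have 0: "f z = (deriv ^^ 0) g z" if "z \<in> cball 0 1" for z using assms(4)[OF that] by simp
  show "f \<in> disc_smooth"
    by (rule disc_smooth_sequenceI(1)[where F = "\<lambda>n. (deriv ^^ n) g", OF 0 *])
  show "(disc_deriv ^^ n) f z = (deriv ^^ n) g z" if "z \<in> cball 0 1"
    by (rule disc_smooth_sequenceI(2)[where F = "\<lambda>n. (deriv ^^ n) g", OF 0 * that])
qed

lemma disc_smooth_add:
  assumes "f \<in> disc_smooth" "g \<in> disc_smooth"
  shows "(\<lambda>z. f z + g z) \<in> disc_smooth"
    and "z \<in> cball 0 1 \<Longrightarrow>
      (disc_deriv ^^ n) (\<lambda>z. f z + g z) z = (disc_deriv ^^ n) f z + (disc_deriv ^^ n) g z"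
proof -
  let ?F = "\<lambda>n z. (disc_deriv ^^ n) f z + (disc_deriv ^^ n) g z"
  have *: "(?F n has_field_derivative ?F (Suc n) z) (at z within cball 0 1)" if "z \<in> cball 0 1" for n z
    by (rule DERIV_add[OF disc_smooth_has_field_derivative[OF assms(1) that]
          disc_smooth_has_field_derivative[OF assms(2) that]])
  have 0: "f z + g z = ?F 0 z" for z by simp
  show "(\<lambda>z. f z + g z) \<in> disc_smooth"
    by (rule disc_smooth_sequenceI(1)[where F = ?F, OF 0 *])
  show "(disc_deriv ^^ n) (\<lambda>z. f z + g z) z = ?F n z" if "z \<in> cball 0 1"
    by (rule disc_smooth_sequenceI(2)[where F = ?F, OF 0 * that])
qed

lemma disc_smooth_cmult:
  assumes "f \<in> disc_smooth"
  shows "(\<lambda>z. c * f z) \<in> disc_smooth"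
    and "z \<in> cball 0 1 \<Longrightarrow> (disc_deriv ^^ n) (\<lambda>z. c * f z) z = c * (disc_deriv ^^ n) f z"
proof -
  let ?F = "\<lambda>n z. c * (disc_deriv ^^ n) f z"
  have *: "(?F n has_field_derivative ?F (Suc n) z) (at z within cball 0 1)" if "z \<in> cball 0 1" for n z
    by (rule DERIV_cmult[OF disc_smooth_has_field_derivative[OF assms that]])
  have 0: "c * f z = ?F 0 z" for z by simp
  show "(\<lambda>z. c * f z) \<in> disc_smooth"
    by (rule disc_smooth_sequenceI(1)[where F = ?F, OF 0 *])
  show "(disc_deriv ^^ n) (\<lambda>z. c * f z) z = ?F n z" if "z \<in> cball 0 1"
    by (rule disc_smooth_sequenceI(2)[where F = ?F, OF 0 * that])
qed

text \<open>The derivatives of \<open>f \<circ> \<psi>\<close> are combinations of the functions \<open>f\<^sup>(\<^sup>k\<^sup>) \<circ> \<psi>\<close> (written \<open>a k\<close> below) with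
  coefficients \<open>P n k\<close>, the Bell polynomials of \<open>\<psi>\<close>, which are holomorphic near the disc and satisfy the
  recursion given by the product rule.\<close>

lemma disc_smooth_compose:
  assumes f: "f \<in> disc_smooth" and \<psi>: "analytic_on_disc \<psi>" "\<psi> ` cball 0 1 \<subseteq> cball 0 1"
  shows "f \<circ> \<psi> \<in> disc_smooth"
proof -
  obtain U g where U: "open U" "cball 0 1 \<subseteq> U" "g holomorphic_on U" "\<And>z. z \<in> cball 0 1 \<Longrightarrow> g z = \<psi> z"
    using \<psi>(1) unfolding analytic_on_disc_def by blast
  define a where "a k z = (disc_deriv ^^ k) f (\<psi> z)" for k z
  have d\<psi>: "(\<psi> has_field_derivative deriv g z) (at z within cball 0 1)" if "z \<in> cball 0 1" for z
  proof (rule has_field_derivative_transform_within[where f = g and d = 1])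
    show "(g has_field_derivative deriv g z) (at z within cball 0 1)"
      using U that by (meson holomorphic_derivI subsetD has_field_derivative_at_within)
  qed (use U that in auto)
  have da: "(a k has_field_derivative a (Suc k) z * deriv g z) (at z within cball 0 1)"
    if z: "z \<in> cball 0 1" for k z
  proof -
    have \<psi>z: "\<psi> z \<in> cball 0 1" using z \<psi>(2) by blast
    have "((disc_deriv ^^ k) f has_field_derivative (disc_deriv ^^ Suc k) f (\<psi> z))
        (at (\<psi> z) within \<psi> ` cball 0 1)"
      using disc_smooth_has_field_derivative[OF f \<psi>z] \<psi>(2) by (rule DERIV_subset)
    from DERIV_image_chain[OF this d\<psi>[OF z]] show ?thesis by (simp add: a_def[abs_def] o_def)
  qed
  define P where "P = rec_nat (\<lambda>k::nat. (\<lambda>z::complex. if k = 0 then 1 else 0))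
    (\<lambda>n p. (\<lambda>k z. deriv (p k) z + (if k = 0 then 0 else deriv g z * p (k - 1) z)))"
  have P0: "P 0 k z = (if k = 0 then 1 else 0)" for k z by (simp add: P_def)
  have PS: "P (Suc n) k = (\<lambda>z. deriv (P n k) z + (if k = 0 then 0 else deriv g z * P n (k - 1) z))" for n k
    unfolding P_def by simp
  have Phol: "P n k holomorphic_on U" for n k
  proof (induction n arbitrary: k)
    case 0 show ?case unfolding P_def by simp
  next
    case (Suc n)
    show ?case unfolding PS
      by (cases "k = 0") (auto intro!: holomorphic_intros holomorphic_deriv Suc U)
  qed
  have dP: "(P n k has_field_derivative deriv (P n k) z) (at z within cball 0 1)"
    if "z \<in> cball 0 1" for n k z
    using Phol U that by (meson holomorphic_derivI subsetD has_field_derivative_at_within)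
  have Pbig: "\<forall>z\<in>cball 0 1. P n k z = 0" if "n < k" for n k
    using that
  proof (induction n arbitrary: k)
    case (Suc n)
    show ?case
    proof
      fix z :: complex assume z: "z \<in> cball 0 1"
      have "((\<lambda>_. 0) has_field_derivative deriv (P n k) z) (at z within cball 0 1)"
        by (rule has_field_derivative_transform_within[OF dP[OF z, of n k], of 1]) (use Suc z in auto)
      from disc_deriv_eqI[OF this z] disc_deriv_eqI[OF DERIV_const z, of 0]
      have "deriv (P n k) z = 0" by simp
      thus "P (Suc n) k z = 0" using Suc z by (auto simp: PS)
    qed
  qed (simp add: P0)
  define F where "F n z = (\<Sum>k\<le>n. a k z * P n k z)" for n z
  have dF: "(F n has_field_derivative F (Suc n) z) (at z within cball 0 1)" if z: "z \<in> cball 0 1" for n z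
  proof -
    have "(F n has_field_derivative (\<Sum>k\<le>n. a (Suc k) z * deriv g z * P n k z + deriv (P n k) z * a k z))
        (at z within cball 0 1)"
      unfolding F_def[abs_def] by (intro DERIV_sum DERIV_mult da dP z)
    also have "(\<Sum>k\<le>n. a (Suc k) z * deriv g z * P n k z + deriv (P n k) z * a k z) =
        (\<Sum>k\<le>n. a (Suc k) z * (deriv g z * P n k z)) + (\<Sum>k\<le>n. a k z * deriv (P n k) z)"
      by (simp add: sum.distrib mult_ac)
    also have "(\<Sum>k\<le>n. a k z * deriv (P n k) z) = (\<Sum>k\<le>Suc n. a k z * deriv (P n k) z)"
    proof -
      have "((\<lambda>_. 0) has_field_derivative deriv (P n (Suc n)) z) (at z within cball 0 1)"
        by (rule has_field_derivative_transform_within[OF dP[OF z, of n "Suc n"], of 1])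
          (use Pbig[of n "Suc n"] z in auto)
      from disc_deriv_eqI[OF this z] disc_deriv_eqI[OF DERIV_const z, of 0]
      have "deriv (P n (Suc n)) z = 0" by simp
      thus ?thesis by simp
    qed
    also have "(\<Sum>k\<le>n. a (Suc k) z * (deriv g z * P n k z)) =
        (\<Sum>k\<le>Suc n. a k z * (if k = 0 then 0 else deriv g z * P n (k - 1) z))"
      by (subst sum.atMost_Suc_shift) simp
    also have "\<dots> + (\<Sum>k\<le>Suc n. a k z * deriv (P n k) z) = F (Suc n) z"
      unfolding F_def sum.distrib[symmetric] PS
        by (intro sum.cong refl) (simp only: distrib_left add.commute)
    finally show ?thesis .
  qed
  show ?thesis
    by (rule disc_smooth_sequenceI(1)[of _ F]) (use dF in \<open>auto simp: F_def a_def P0\<close>)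
qed

section \<open>The norm of the algebra\<close>

lemma norm_le_disc_sup_norm:
  assumes "f \<in> disc_smooth" "z \<in> cball 0 1"
  shows "norm ((disc_deriv ^^ n) f z) \<le> disc_sup_norm ((disc_deriv ^^ n) f)"
proof -
  have "compact ((\<lambda>z. norm ((disc_deriv ^^ n) f z)) ` cball 0 1)"
    by (intro compact_continuous_image continuous_intros disc_smooth_continuous assms) auto
  hence "bdd_above ((\<lambda>z. norm ((disc_deriv ^^ n) f z)) ` cball 0 1)"
    by (simp add: bounded_imp_bdd_above compact_imp_bounded)
  thus ?thesis unfolding disc_sup_norm_def using assms by (intro cSUP_upper)
qed

lemma disc_sup_norm_le:
  assumes "\<And>z. z \<in> cball 0 1 \<Longrightarrow> norm (f z) \<le> B"
  shows "disc_sup_norm f \<le> B"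
  unfolding disc_sup_norm_def using assms by (intro cSUP_least) auto

lemma disc_sup_norm_le_interior:
  assumes "continuous_on (cball 0 1) f" "\<And>z. z \<in> ball 0 1 \<Longrightarrow> norm (f z) \<le> B"
  shows "disc_sup_norm f \<le> B"
proof (rule disc_sup_norm_le)
  fix z :: complex assume "z \<in> cball 0 1"
  thus "norm (f z) \<le> B"
    using continuous_on_closure_norm_le[of "ball 0 1" f B z] assms by (simp add: closure_ball)
qed

lemma disc_sup_norm_nonneg:
  assumes "f \<in> disc_smooth"
  shows "0 \<le> disc_sup_norm ((disc_deriv ^^ n) f)"
  by (rule order_trans[OF norm_ge_zero norm_le_disc_sup_norm[OF assms, of 0]]) simp

lemma disc_sup_norm_add_le:
  assumes "f \<in> disc_smooth" "g \<in> disc_smooth"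
  shows "disc_sup_norm ((disc_deriv ^^ n) (\<lambda>z. f z + g z))
    \<le> disc_sup_norm ((disc_deriv ^^ n) f) + disc_sup_norm ((disc_deriv ^^ n) g)"
proof (rule disc_sup_norm_le)
  fix z :: complex assume z: "z \<in> cball 0 1"
  show "norm ((disc_deriv ^^ n) (\<lambda>z. f z + g z) z)
      \<le> disc_sup_norm ((disc_deriv ^^ n) f) + disc_sup_norm ((disc_deriv ^^ n) g)"
    unfolding disc_smooth_add(2)[OF assms z]
    by (rule order_trans[OF norm_triangle_ineq add_mono[OF norm_le_disc_sup_norm[OF assms(1) z]
          norm_le_disc_sup_norm[OF assms(2) z]]])
qed

lemma disc_sup_norm_cmult:
  assumes "f \<in> disc_smooth"
  shows "disc_sup_norm ((disc_deriv ^^ n) (\<lambda>z. c * f z)) = norm c * disc_sup_norm ((disc_deriv ^^ n) f)"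
proof -
  have *: "disc_sup_norm ((disc_deriv ^^ n) (\<lambda>z. c * f z)) \<le> norm c * disc_sup_norm ((disc_deriv ^^ n) f)"
    if "f \<in> disc_smooth" for c f
  proof (rule disc_sup_norm_le)
    fix z :: complex assume z: "z \<in> cball 0 1"
    show "norm ((disc_deriv ^^ n) (\<lambda>z. c * f z) z) \<le> norm c * disc_sup_norm ((disc_deriv ^^ n) f)"
      unfolding disc_smooth_cmult(2)[OF that z] norm_mult
      by (rule mult_left_mono[OF norm_le_disc_sup_norm[OF that z] norm_ge_zero])
  qed
  have "norm c * disc_sup_norm ((disc_deriv ^^ n) f) \<le> disc_sup_norm ((disc_deriv ^^ n) (\<lambda>z. c * f z))"
  proof (cases "c = 0")
    case True
    thus ?thesis using disc_sup_norm_nonneg[OF disc_smooth_cmult(1)[OF assms, of c]] by simp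
  next
    case False
    have "disc_sup_norm ((disc_deriv ^^ n) f) = disc_sup_norm ((disc_deriv ^^ n) (\<lambda>z. inverse c * (c * f z)))"
      using False by (simp add: mult.assoc[symmetric])
    also have "\<dots> \<le> norm (inverse c) * disc_sup_norm ((disc_deriv ^^ n) (\<lambda>z. c * f z))"
      by (rule *) (rule disc_smooth_cmult assms)+
    finally have "disc_sup_norm ((disc_deriv ^^ n) f)
        \<le> disc_sup_norm ((disc_deriv ^^ n) (\<lambda>z. c * f z)) / norm c"
      using False by (simp add: norm_inverse divide_inverse mult.commute)
    thus ?thesis using False by (simp add: pos_le_divide_eq mult.commute)
  qed
  with *[OF assms] show ?thesis by (simp add: antisym)
qed

text \<open>The Banach algebra norm \<open>\<Sum>\<^sub>n \<parallel>f\<^sup>(\<^sup>n\<^sup>)\<parallel> / M\<^sub>n\<close>. The value is meaningful only on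
  \<^term>\<open>disc_algebra M\<close>, where the series converges.\<close>

definition disc_algebra_norm :: "(nat \<Rightarrow> real) \<Rightarrow> (complex \<Rightarrow> complex) \<Rightarrow> real" where
  "disc_algebra_norm M f = (\<Sum>n. disc_sup_norm ((disc_deriv ^^ n) f) / M n)"

lemma disc_algebra_smooth: "f \<in> disc_algebra M \<Longrightarrow> f \<in> disc_smooth"
  by (simp add: disc_algebra_def)

lemma disc_algebra_terms_nonneg:
  assumes "weight_sequence M" "f \<in> disc_smooth"
  shows "0 \<le> disc_sup_norm ((disc_deriv ^^ n) f) / M n"
  using assms disc_sup_norm_nonneg by (auto simp: weight_sequence_def less_imp_le)

lemma disc_algebra_sum_le_norm:
  assumes "weight_sequence M" "f \<in> disc_algebra M" "finite I"
  shows "(\<Sum>n\<in>I. disc_sup_norm ((disc_deriv ^^ n) f) / M n) \<le> disc_algebra_norm M f"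
  unfolding disc_algebra_norm_def using assms disc_algebra_terms_nonneg
  by (intro sum_le_suminf) (auto simp: disc_algebra_def)

lemma disc_algebra_norm_nonneg:
  assumes "weight_sequence M" "f \<in> disc_algebra M"
  shows "0 \<le> disc_algebra_norm M f"
  using disc_algebra_sum_le_norm[OF assms, of "{}"] by simp

lemma disc_sup_norm_le_algebra_norm:
  assumes "weight_sequence M" "f \<in> disc_algebra M"
  shows "disc_sup_norm ((disc_deriv ^^ n) f) \<le> M n * disc_algebra_norm M f"
  using disc_algebra_sum_le_norm[OF assms, of "{n}"] assms(1)
  by (auto simp: weight_sequence_def field_simps)

lemma disc_algebraI:
  assumes "weight_sequence M" "f \<in> disc_smooth"
    and "\<And>N. (\<Sum>n<N. disc_sup_norm ((disc_deriv ^^ n) f) / M n) \<le> B"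
  shows "f \<in> disc_algebra M" and "disc_algebra_norm M f \<le> B"
proof -
  have "summable (\<lambda>n. disc_sup_norm ((disc_deriv ^^ n) f) / M n)"
    using disc_algebra_terms_nonneg[OF assms(1,2)] assms(3)
    by (intro summableI_nonneg_bounded[of _ B]) auto
  thus "f \<in> disc_algebra M" "disc_algebra_norm M f \<le> B"
    using assms(2,3) suminf_le_const by (auto simp: disc_algebra_def disc_algebra_norm_def)
qed

section \<open>Majorants for composition\<close>

lemma fps_power_nonneg:
  fixes g :: "real fps"
  assumes "\<And>n. 0 \<le> fps_nth g n"
  shows "0 \<le> fps_nth (g ^ k) n"
proof (induction k arbitrary: n)
  case (Suc k)
  show ?case unfolding power_Suc fps_mult_nth by (intro sum_nonneg mult_nonneg_nonneg assms Suc)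
qed (simp add: fps_one_nth)

lemma fps_power_majorant:
  fixes G :: "complex fps" and g :: "real fps"
  assumes "\<And>n. norm (fps_nth G n) \<le> fps_nth g n"
  shows "norm (fps_nth (G ^ k) n) \<le> fps_nth (g ^ k) n"
proof (induction k arbitrary: n)
  case (Suc k)
  show ?case unfolding power_Suc fps_mult_nth
    by (intro sum_norm_le) (simp add: norm_mult mult_mono' assms Suc)
qed (simp add: fps_one_nth)

lemma fps_power_partial_sum_le:
  fixes g :: "real fps"
  assumes g: "\<And>n. 0 \<le> fps_nth g n" and \<epsilon>: "0 \<le> \<epsilon>" and S: "(\<Sum>n<N. \<epsilon> ^ n * fps_nth g n) \<le> S"
  shows "(\<Sum>n<N. \<epsilon> ^ n * fps_nth (g ^ k) n) \<le> S ^ k"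
proof (induction k)
  case 0
  have "(\<Sum>n<N. \<epsilon> ^ n * fps_nth (g ^ 0) n) = (\<Sum>n<N. if n = 0 then 1 else 0)"
    by (intro sum.cong) (auto simp: fps_one_nth)
  also have "\<dots> \<le> (1::real)" by (cases N) (auto simp: sum.lessThan_Suc_shift simp del: sum.lessThan_Suc)
  finally show ?case by simp
next
  case (Suc k)
  let ?a = "\<lambda>i. \<epsilon> ^ i * fps_nth g i" and ?b = "\<lambda>i. \<epsilon> ^ i * fps_nth (g ^ k) i"
  have nn: "0 \<le> ?a i" "0 \<le> ?b i" for i using g \<epsilon> fps_power_nonneg[OF g] by auto
  have "(\<Sum>n<N. \<epsilon> ^ n * fps_nth (g ^ Suc k) n) = (\<Sum>n<N. \<Sum>i\<le>n. ?a i * ?b (n - i))"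
    unfolding power_Suc fps_mult_nth sum_distrib_left atLeast0AtMost
  proof (intro sum.cong refl)
    fix n i :: nat assume "i \<in> {..n}"
    hence "\<epsilon> ^ n = \<epsilon> ^ i * \<epsilon> ^ (n - i)" by (simp add: power_add[symmetric])
    thus "\<epsilon> ^ n * (fps_nth g i * fps_nth (g ^ k) (n - i)) = ?a i * ?b (n - i)" by simp
  qed
  also have "\<dots> = (\<Sum>(i, j)\<in>{(i, j). i + j < N}. ?a i * ?b j)"
    by (rule sum.triangle_reindex[symmetric])
  also have "\<dots> \<le> (\<Sum>(i, j)\<in>{..<N} \<times> {..<N}. ?a i * ?b j)"
    using nn by (intro sum_mono2) auto
  also have "\<dots> = (\<Sum>n<N. ?a n) * (\<Sum>n<N. ?b n)"
    by (simp add: sum_product sum.cartesian_product)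
  also have "\<dots> \<le> S * S ^ k"
    using nn S Suc by (intro mult_mono) (auto intro!: sum_nonneg order_trans[OF _ S])
  finally show ?case by simp
qed

lemma analytic_on_disc_smooth:
  assumes "analytic_on_disc \<psi>"
  shows "\<psi> \<in> disc_smooth"
  using assms unfolding analytic_on_disc_def by (blast intro: holomorphic_imp_disc_smooth)

text \<open>The estimate contained in Faa di Bruno's formula: at an interior point the Taylor coefficients of
  \<open>f \<circ> \<psi>\<close> are those of a composition of formal power series, in which the inner series may be replaced by
  a majorant \<open>g\<close>. By continuity interior points suffice for the sup norm.\<close>

lemma disc_sup_norm_compose_le:
  fixes g :: "real fps"
  assumes f: "f \<in> disc_smooth" and \<psi>: "analytic_on_disc \<psi>" "\<psi> ` cball 0 1 \<subseteq> cball 0 1"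
    and inner: "\<psi> ` ball 0 1 \<subseteq> ball 0 1"
    and g0: "0 \<le> fps_nth g 0"
    and g: "\<And>n z. 0 < n \<Longrightarrow> z \<in> ball 0 1 \<Longrightarrow> norm ((disc_deriv ^^ n) \<psi> z) / fact n \<le> fps_nth g n"
  shows "disc_sup_norm ((disc_deriv ^^ n) (f \<circ> \<psi>)) \<le>
    (\<Sum>k\<le>n. fact n / fact k * disc_sup_norm ((disc_deriv ^^ k) f) * fps_nth (g ^ k) n)"
proof (rule disc_sup_norm_le_interior)
  have smooth: "f \<circ> \<psi> \<in> disc_smooth" using disc_smooth_compose[OF f \<psi>] .
  show "continuous_on (cball 0 1) ((disc_deriv ^^ n) (f \<circ> \<psi>))"
    by (rule disc_smooth_continuous[OF smooth])
  fix z :: complex assume z: "z \<in> ball 0 1"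
  define b where "b = \<psi> z"
  have b: "b \<in> ball 0 1" using inner z unfolding b_def by blast
  have \<psi>s: "\<psi> \<in> disc_smooth" by (rule analytic_on_disc_smooth[OF \<psi>(1)])
  have fh: "f holomorphic_on ball 0 1" using disc_smooth_holomorphic[OF f, of 0] by simp
  have \<psi>h: "\<psi> holomorphic_on ball 0 1" using disc_smooth_holomorphic[OF \<psi>s, of 0] by simp
  define f1 where "f1 = f \<circ> (\<lambda>t. b + t)"
  define p1 where "p1 = \<psi> \<circ> (\<lambda>t. z + t)"
  have sub: "(\<lambda>t. c + t) ` ball (- c) 1 \<subseteq> ball 0 1" for c :: complex
    by (auto simp: dist_norm norm_minus_commute)
  have "f1 holomorphic_on ball (- b) 1" unfolding f1_def
    by (rule holomorphic_on_compose_gen[OF _ fh sub]) (intro holomorphic_intros)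
  hence f1: "f1 has_fps_expansion fps_expansion f1 0"
    using b by (intro has_fps_expansion_fps_expansion[of "ball (- b) 1"]) auto
  have "p1 holomorphic_on ball (- z) 1" unfolding p1_def
    by (rule holomorphic_on_compose_gen[OF _ \<psi>h sub]) (intro holomorphic_intros)
  hence p1: "p1 has_fps_expansion fps_expansion p1 0"
    using z by (intro has_fps_expansion_fps_expansion[of "ball (- z) 1"]) auto
  define F where "F = fps_expansion f1 0"
  define G where "G = fps_expansion p1 0 - fps_const b"
  have G: "(\<lambda>t. p1 t - b) has_fps_expansion G"
    unfolding G_def by (intro has_fps_expansion_diff p1 has_fps_expansion_const)
  have Fnth: "norm (fps_nth F k) \<le> disc_sup_norm ((disc_deriv ^^ k) f) / fact k" for k
  proof -
    have "fps_nth F k = (disc_deriv ^^ k) f b / fact k"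
      using fps_nth_fps_expansion[OF f1, of k]
      unfolding F_def disc_deriv_eq_higher_deriv_interior[OF f b] higher_deriv_shift_0[of k f b]
        f1_def[symmetric] by simp
    thus ?thesis using norm_le_disc_sup_norm[OF f, of b k] b
      by (simp add: norm_divide divide_right_mono)
  qed
  have G0: "fps_nth G 0 = 0"
    using fps_nth_fps_expansion[OF p1, of 0] by (simp add: G_def p1_def b_def)
  have Gnth: "norm (fps_nth G k) \<le> fps_nth g k" for k
  proof (cases "k = 0")
    case False
    hence "fps_nth G k = (disc_deriv ^^ k) \<psi> z / fact k"
      using fps_nth_fps_expansion[OF p1, of k]
      unfolding G_def disc_deriv_eq_higher_deriv_interior[OF \<psi>s z] higher_deriv_shift_0[of k \<psi> z]
        p1_def[symmetric] by simp
    thus ?thesis using g[of k z] False z by (simp add: norm_divide)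
  qed (simp add: G0 g0)
  have "(f1 \<circ> (\<lambda>t. p1 t - b)) has_fps_expansion (F oo G)"
    using has_fps_expansion_compose[OF f1 G G0] by (simp add: F_def)
  from fps_nth_fps_expansion[OF this, of n]
  have "(deriv ^^ n) (f1 \<circ> (\<lambda>t. p1 t - b)) 0 = fact n * fps_nth (F oo G) n" by simp
  also have "f1 \<circ> (\<lambda>t. p1 t - b) = (f \<circ> \<psi>) \<circ> (\<lambda>t. z + t)"
    by (auto simp: f1_def p1_def)
  finally have "(disc_deriv ^^ n) (f \<circ> \<psi>) z = fact n * fps_nth (F oo G) n"
    unfolding disc_deriv_eq_higher_deriv_interior[OF smooth z] higher_deriv_shift_0[of n "f \<circ> \<psi>" z] .
  hence "norm ((disc_deriv ^^ n) (f \<circ> \<psi>) z) = fact n * norm (\<Sum>k\<le>n. fps_nth F k * fps_nth (G ^ k) n)"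
    by (simp add: fps_compose_nth norm_mult atLeast0AtMost)
  also have "\<dots> \<le> fact n * (\<Sum>k\<le>n. disc_sup_norm ((disc_deriv ^^ k) f) / fact k * fps_nth (g ^ k) n)"
  proof (rule mult_left_mono[OF sum_norm_le])
    fix k
    show "norm (fps_nth F k * fps_nth (G ^ k) n) \<le> disc_sup_norm ((disc_deriv ^^ k) f) / fact k * fps_nth (g ^ k) n"
      unfolding norm_mult by (rule mult_mono'[OF Fnth fps_power_majorant[OF Gnth]]) simp_all
  qed simp
  finally show "norm ((disc_deriv ^^ n) (f \<circ> \<psi>) z) \<le>
      (\<Sum>k\<le>n. fact n / fact k * disc_sup_norm ((disc_deriv ^^ k) f) * fps_nth (g ^ k) n)"
    by (simp add: sum_distrib_left mult_ac)
qed

lemma analytic_on_disc_extension: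
  assumes "analytic_on_disc \<psi>"
  obtains \<delta> g where "0 < \<delta>" "g holomorphic_on ball 0 (1 + \<delta>)" "\<And>z. z \<in> cball 0 1 \<Longrightarrow> g z = \<psi> z"
proof -
  obtain U g where U: "open U" "cball 0 1 \<subseteq> U" "g holomorphic_on U" "\<And>z. z \<in> cball 0 1 \<Longrightarrow> g z = \<psi> z"
    using assms unfolding analytic_on_disc_def by blast
  obtain e where e: "e > 0" "\<And>x. x \<in> cball 0 1 \<Longrightarrow> ball x e \<subseteq> U"
    using Lebesgue_number_lemma[of "cball (0::complex) 1" "{U}"] U
    by (metis (no_types, lifting) compact_subset_open_imp_ball_epsilon_subset UN_subset_iff compact_cball)
  have "ball 0 (1 + e) \<subseteq> U"
  proof
    fix z :: complex assume z: "z \<in> ball 0 (1 + e)"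
    show "z \<in> U"
    proof (cases "norm z \<le> 1")
      case False
      have "norm (z / norm z - z) = norm z - 1"
      proof -
        have "z / norm z - z = (1 - norm z) * (z / norm z)"
          using False by (auto simp: divide_simps algebra_simps)
        hence "norm (z / norm z - z) = \<bar>1 - norm z\<bar> * norm (z / norm z)"
          by (metis norm_mult norm_of_real of_real_1 of_real_diff)
        thus ?thesis using False by (auto simp: norm_divide)
      qed
      hence "z \<in> ball (z / norm z) e" using z by (simp add: dist_norm)
      moreover have "z / norm z \<in> cball 0 1" by (simp add: norm_divide)
      ultimately show ?thesis using e(2) by blast
    qed (use U in auto)
  qed
  thus thesis using U e(1) that[of e g] holomorphic_on_subset by blast
qed

lemma analytic_on_disc_Cauchy_bounds:
  assumes "analytic_on_disc \<psi>"
  obtains A B where "0 < A" "0 < B"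
    "\<And>n z. z \<in> cball 0 1 \<Longrightarrow> norm ((disc_deriv ^^ n) \<psi> z) \<le> fact n * (B * A ^ n)"
proof -
  obtain \<delta> g where g: "0 < \<delta>" "g holomorphic_on ball 0 (1 + \<delta>)" "\<And>z. z \<in> cball 0 1 \<Longrightarrow> g z = \<psi> z"
    using analytic_on_disc_extension[OF assms] by blast
  have gc: "g holomorphic_on cball 0 (1 + \<delta> / 2)"
    by (rule holomorphic_on_subset[OF g(2)]) (use g(1) in auto)
  have "compact (g ` cball 0 (1 + \<delta> / 2))"
    by (intro compact_continuous_image holomorphic_on_imp_continuous_on gc) auto
  then obtain B where B: "B > 0" "\<forall>z\<in>cball 0 (1 + \<delta> / 2). norm (g z) \<le> B"
    by (metis compact_imp_bounded bounded_pos image_eqI)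
  have "norm ((disc_deriv ^^ n) \<psi> z) \<le> fact n * (B * (2 / \<delta>) ^ n)" if z: "z \<in> cball 0 1" for n z
  proof -
    have sub: "cball z (\<delta> / 2) \<subseteq> cball 0 (1 + \<delta> / 2)"
      using z by (intro cball_subset_cball_iff[THEN iffD2]) (auto simp: dist_norm)
    have "norm ((deriv ^^ n) g z) \<le> fact n * B / (\<delta> / 2) ^ n"
    proof (rule Cauchy_inequality)
      show "g holomorphic_on ball z (\<delta> / 2)"
        using gc by (rule holomorphic_on_subset) (use sub ball_subset_cball in blast)
      show "continuous_on (cball z (\<delta> / 2)) g"
        by (rule holomorphic_on_imp_continuous_on[OF holomorphic_on_subset[OF gc sub]])
      show "norm (g x) \<le> B" if "norm (z - x) = \<delta> / 2" for x
      proof -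
        have "x \<in> cball z (\<delta> / 2)" using that by (simp add: dist_norm)
        thus ?thesis using B sub by blast
      qed
    qed (use g in auto)
    also have "(deriv ^^ n) g z = (disc_deriv ^^ n) \<psi> z"
    proof -
      have "cball (0::complex) 1 \<subseteq> ball 0 (1 + \<delta>)" using g(1) by auto
      from holomorphic_imp_disc_smooth(2)[OF open_ball this g(2,3) z] show ?thesis by simp
    qed
    finally show ?thesis by (simp add: power_divide field_simps)
  qed
  thus thesis using that[of "2 / \<delta>" B] g(1) B(1) by simp
qed

section \<open>Analytic maps and the weights\<close>

lemma weight_sequence_fact_ratio:
  assumes M: "weight_sequence M" and "k \<le> n"
  shows "fact n / (fact k * M n) \<le> fact (n - k) / (M (n - k) * M k)"
proof -
  have pos: "M i > 0" for i using M by (simp add: weight_sequence_def)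
  have "real ((k + (n - k)) choose (n - k)) \<le> M (k + (n - k)) / (M k * M (n - k))"
    using M by (simp only: weight_sequence_def)
  moreover have "real (n choose (n - k)) = fact n / (fact (n - k) * fact k)"
    using assms(2) by (subst binomial_fact) auto
  ultimately have "fact n / (fact (n - k) * fact k) \<le> M n / (M k * M (n - k))"
    using assms(2) by simp
  thus ?thesis using pos[of k] pos[of n] pos[of "n - k"] by (simp add: divide_simps mult_ac)
qed

lemma nonanalytic_bound:
  assumes M: "weight_sequence M" "nonanalytic M" and \<epsilon>: "0 < \<epsilon>"
  obtains C where "0 < C" "\<And>n. fact n / M n \<le> C * \<epsilon> ^ n"
proof -
  have pos: "M i > 0" for i using M by (simp add: weight_sequence_def)
  have "\<forall>\<^sub>F n in sequentially. root n (fact n / M n) < \<epsilon>"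
    using M(2) \<epsilon> unfolding nonanalytic_def by (rule order_tendstoD)
  then obtain n0 where n0: "\<And>n. n \<ge> n0 \<Longrightarrow> root n (fact n / M n) < \<epsilon>"
    unfolding eventually_sequentially by blast
  define C where "C = 1 + (\<Sum>n\<le>n0. fact n / M n / \<epsilon> ^ n)"
  have nn: "0 \<le> fact n / M n / \<epsilon> ^ n" for n using pos[of n] \<epsilon> by auto
  have C1: "1 \<le> C" unfolding C_def using nn by (simp add: sum_nonneg)
  have "fact n / M n \<le> C * \<epsilon> ^ n" for n
  proof (cases "n \<le> n0")
    case True
    have "fact n / M n / \<epsilon> ^ n \<le> (\<Sum>n\<le>n0. fact n / M n / \<epsilon> ^ n)"
      using True nn by (intro member_le_sum) auto
    hence "fact n / M n / \<epsilon> ^ n \<le> C" unfolding C_def by linarith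
    thus ?thesis using \<epsilon> by (simp only: pos_divide_le_eq zero_less_power)
  next
    case False
    have "fact n / M n = root n (fact n / M n) ^ n"
      using False pos[of n] by (simp add: less_imp_le)
    also have "\<dots> \<le> \<epsilon> ^ n"
      using n0[of n] False pos[of n] by (intro power_mono) (auto simp: less_imp_le real_root_ge_zero)
    also have "\<dots> \<le> C * \<epsilon> ^ n" using C1 \<epsilon> by simp
    finally show ?thesis .
  qed
  thus thesis by (intro that[of C]) (use C1 in simp_all)
qed

lemma analytic_on_disc_imp_disc_algebra:
  assumes M: "weight_sequence M" "nonanalytic M" and \<psi>: "analytic_on_disc \<psi>"
  shows "\<psi> \<in> disc_algebra M"
proof -
  have pos: "M i > 0" for i using M by (simp add: weight_sequence_def)
  obtain A B where AB: "0 < A" "0 < B"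
    "\<And>n z. z \<in> cball 0 1 \<Longrightarrow> norm ((disc_deriv ^^ n) \<psi> z) \<le> fact n * (B * A ^ n)"
    using analytic_on_disc_Cauchy_bounds[OF \<psi>] by blast
  obtain C where C: "0 < C" "\<And>n. fact n / M n \<le> C * (1 / (2 * A)) ^ n"
    using nonanalytic_bound[OF M, of "1 / (2 * A)"] AB by auto
  have "disc_sup_norm ((disc_deriv ^^ n) \<psi>) / M n \<le> C * B * (1 / 2) ^ n" for n
  proof -
    have "disc_sup_norm ((disc_deriv ^^ n) \<psi>) / M n \<le> fact n * (B * A ^ n) / M n"
      using pos by (intro divide_right_mono disc_sup_norm_le AB) (auto simp: less_imp_le)
    also have "\<dots> = fact n / M n * (B * A ^ n)" by simp
    also have "\<dots> \<le> C * (1 / (2 * A)) ^ n * (B * A ^ n)"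
      using AB by (intro mult_right_mono C) auto
    also have "\<dots> = C * B * (1 / 2) ^ n" using AB by (simp add: power_divide power_mult_distrib)
    finally show ?thesis .
  qed
  hence "norm (disc_sup_norm ((disc_deriv ^^ n) \<psi>) / M n) \<le> C * B * (1 / 2) ^ n" for n
    unfolding real_norm_def abs_of_nonneg[OF disc_algebra_terms_nonneg[OF M(1) analytic_on_disc_smooth[OF \<psi>]]] .
  moreover have "summable (\<lambda>n. C * B * (1 / 2) ^ n)"
    by (intro summable_mult summable_geometric) auto
  ultimately have "summable (\<lambda>n. disc_sup_norm ((disc_deriv ^^ n) \<psi>) / M n)"
    by (rule summable_comparison_test'[rotated])
  thus ?thesis using analytic_on_disc_smooth[OF \<psi>] by (simp add: disc_algebra_def)
qed

text \<open>For small \<open>\<epsilon> > 0\<close> the majorant \<open>g(t) = q t + B (A t)\<^sup>2 / (1 - A t)\<close> satisfies \<open>g(\<epsilon>) \<le> \<epsilon>\<close>, hence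
  \<open>g(\<epsilon>)\<^sup>k \<le> \<epsilon>\<^sup>k\<close>. The weight \<open>n! / (k! M\<^sub>n)\<close> in Faa di Bruno's formula is at most \<open>C \<epsilon>\<^sup>n\<^sup>-\<^sup>k / M\<^sub>k\<close>, and the two powers
  of \<open>\<epsilon>\<close> cancel after summation over \<open>n\<close>.\<close>

lemma contraction_induces_endomorphism:
  assumes M: "weight_sequence M" "nonanalytic M"
    and \<psi>: "analytic_on_disc \<psi>" "\<psi> ` cball 0 1 \<subseteq> cball 0 1" "\<psi> ` ball 0 1 \<subseteq> ball 0 1"
    and q: "q < 1" "\<And>z. z \<in> cball 0 1 \<Longrightarrow> norm (disc_deriv \<psi> z) \<le> q"
  shows "induces_endomorphism M \<psi>"
  unfolding induces_endomorphism_def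
proof
  fix f assume f: "f \<in> disc_algebra M"
  have pos: "M i > 0" for i using M by (simp add: weight_sequence_def)
  have fs: "f \<in> disc_smooth" using f by (rule disc_algebra_smooth)
  obtain A B where AB: "0 < A" "0 < B"
    "\<And>n z. z \<in> cball 0 1 \<Longrightarrow> norm ((disc_deriv ^^ n) \<psi> z) \<le> fact n * (B * A ^ n)"
    using analytic_on_disc_Cauchy_bounds[OF \<psi>(1)] by blast
  have q0: "0 \<le> q" by (rule order_trans[OF norm_ge_zero q(2)[of 0]]) simp
  define g where "g = Abs_fps (\<lambda>n. if n = 0 then 0 else if n = 1 then q else B * A ^ n)"
  have gn: "fps_nth g n = (if n = 0 then 0 else if n = 1 then q else B * A ^ n)" for n
    by (simp add: g_def)
  have gnn: "0 \<le> fps_nth g n" for n using AB q0 by (simp add: gn)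
  define \<epsilon> where "\<epsilon> = min (1 / (2 * A)) ((1 - q) / (2 * B * A\<^sup>2))"
  have \<epsilon>: "0 < \<epsilon>" "A * \<epsilon> \<le> 1 / 2" "2 * B * A\<^sup>2 * \<epsilon> \<le> 1 - q"
  proof -
    show "0 < \<epsilon>" using AB q by (simp add: \<epsilon>_def)
    have "\<epsilon> \<le> 1 / (2 * A)" by (simp add: \<epsilon>_def)
    thus "A * \<epsilon> \<le> 1 / 2" using AB by (simp add: field_simps)
    have "\<epsilon> \<le> (1 - q) / (2 * B * A\<^sup>2)" by (simp add: \<epsilon>_def)
    thus "2 * B * A\<^sup>2 * \<epsilon> \<le> 1 - q" using AB by (simp add: pos_le_divide_eq mult_ac)
  qed
  have geps: "(\<Sum>n<N. \<epsilon> ^ n * fps_nth g n) \<le> \<epsilon>" for N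
  proof -
    have "(\<Sum>n<N. \<epsilon> ^ n * fps_nth g n) \<le> (\<Sum>n<N + 2. \<epsilon> ^ n * fps_nth g n)"
      using \<epsilon> gnn by (intro sum_mono2) auto
    also have "\<dots> = \<epsilon> * q + (\<Sum>n<N. \<epsilon> ^ (n + 2) * fps_nth g (n + 2))"
      by (simp add: sum.lessThan_Suc_shift gn del: sum.lessThan_Suc)
    also have "(\<Sum>n<N. \<epsilon> ^ (n + 2) * fps_nth g (n + 2)) = B * (A * \<epsilon>)\<^sup>2 * (\<Sum>n<N. (A * \<epsilon>) ^ n)"
      by (simp add: gn sum_distrib_left power_mult_distrib power_add mult_ac power2_eq_square)
    also have "(\<Sum>n<N. (A * \<epsilon>) ^ n) \<le> (\<Sum>n. (A * \<epsilon>) ^ n)"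
      using \<epsilon> AB by (intro sum_le_suminf summable_geometric) auto
    also have "(\<Sum>n. (A * \<epsilon>) ^ n) = 1 / (1 - A * \<epsilon>)"
      using \<epsilon> AB by (intro suminf_geometric) auto
    also have "1 / (1 - A * \<epsilon>) \<le> 2" using \<epsilon> by (simp add: divide_simps)
    also have "\<epsilon> * q + B * (A * \<epsilon>)\<^sup>2 * 2 = \<epsilon> * (q + 2 * B * A\<^sup>2 * \<epsilon>)"
      by (simp add: power2_eq_square algebra_simps)
    also have "\<dots> \<le> \<epsilon> * 1" using \<epsilon> by (intro mult_left_mono) auto
    finally show ?thesis using AB by (simp add: mult_left_mono)
  qed
  obtain C where C: "0 < C" "\<And>n. fact n / M n \<le> C * \<epsilon> ^ n"
    using nonanalytic_bound[OF M \<epsilon>(1)] by blast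
  define s where "s k = disc_sup_norm ((disc_deriv ^^ k) f)" for k
  have s0: "0 \<le> s k" for k unfolding s_def by (rule disc_sup_norm_nonneg[OF fs])
  have le: "disc_sup_norm ((disc_deriv ^^ n) (f \<circ> \<psi>)) \<le>
      (\<Sum>k\<le>n. fact n / fact k * s k * fps_nth (g ^ k) n)" for n
    unfolding s_def
  proof (rule disc_sup_norm_compose_le[OF fs \<psi>])
    show "norm ((disc_deriv ^^ n) \<psi> z) / fact n \<le> fps_nth g n" if "0 < n" "z \<in> ball 0 1" for n z
      using that q(2)[of z] AB(3)[of z n] by (auto simp: gn field_simps)
  qed (simp add: gn)
  have coeff: "fact n / fact k / M n \<le> C * (\<epsilon> ^ n / \<epsilon> ^ k) / M k" if "k \<le> n" for n k
  proof -
    have "fact n / fact k / M n \<le> fact (n - k) / M (n - k) / M k"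
      using weight_sequence_fact_ratio[OF M(1) that] by simp
    also have "\<dots> \<le> C * \<epsilon> ^ (n - k) / M k"
      using pos by (intro divide_right_mono C) (auto simp: less_imp_le)
    finally show ?thesis using that \<epsilon> by (simp add: power_diff)
  qed
  have "(\<Sum>n<N. disc_sup_norm ((disc_deriv ^^ n) (f \<circ> \<psi>)) / M n) \<le> C * disc_algebra_norm M f" for N
  proof -
    have "(\<Sum>n<N. disc_sup_norm ((disc_deriv ^^ n) (f \<circ> \<psi>)) / M n) \<le>
        (\<Sum>n<N. \<Sum>k<N. C * (s k / M k) / \<epsilon> ^ k * (\<epsilon> ^ n * fps_nth (g ^ k) n))"
    proof (intro sum_mono)
      fix n assume n: "n \<in> {..<N}"
      have "disc_sup_norm ((disc_deriv ^^ n) (f \<circ> \<psi>)) / M n \<le>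
          (\<Sum>k\<le>n. fact n / fact k * s k * fps_nth (g ^ k) n) / M n"
        using pos by (intro divide_right_mono le) (auto simp: less_imp_le)
      also have "\<dots> = (\<Sum>k\<le>n. fact n / fact k / M n * (s k * fps_nth (g ^ k) n))"
        by (simp add: sum_divide_distrib mult_ac)
      also have "\<dots> \<le> (\<Sum>k\<le>n. C * (\<epsilon> ^ n / \<epsilon> ^ k) / M k * (s k * fps_nth (g ^ k) n))"
        by (intro sum_mono mult_right_mono coeff mult_nonneg_nonneg s0 fps_power_nonneg gnn) auto
      also have "\<dots> \<le> (\<Sum>k<N. C * (\<epsilon> ^ n / \<epsilon> ^ k) / M k * (s k * fps_nth (g ^ k) n))"
        using n C \<epsilon> pos s0 fps_power_nonneg[OF gnn]
        by (intro sum_mono2) (auto simp: less_imp_le)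
      finally show "disc_sup_norm ((disc_deriv ^^ n) (f \<circ> \<psi>)) / M n \<le>
          (\<Sum>k<N. C * (s k / M k) / \<epsilon> ^ k * (\<epsilon> ^ n * fps_nth (g ^ k) n))"
        by (simp add: mult_ac)
    qed
    also have "\<dots> = (\<Sum>k<N. C * (s k / M k) / \<epsilon> ^ k * (\<Sum>n<N. \<epsilon> ^ n * fps_nth (g ^ k) n))"
      by (subst sum.swap) (simp add: sum_distrib_left)
    also have "\<dots> \<le> (\<Sum>k<N. C * (s k / M k) / \<epsilon> ^ k * \<epsilon> ^ k)"
      using C \<epsilon> pos s0
      by (intro sum_mono mult_left_mono fps_power_partial_sum_le gnn geps) (auto simp: less_imp_le)
    also have "\<dots> = C * (\<Sum>k<N. s k / M k)" using \<epsilon> by (simp add: sum_distrib_left)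
    also have "\<dots> \<le> C * disc_algebra_norm M f"
      unfolding s_def using C by (intro mult_left_mono disc_algebra_sum_le_norm M f) auto
    finally show ?thesis .
  qed
  thus "f \<circ> \<psi> \<in> disc_algebra M"
    using disc_algebraI(1)[OF M(1) disc_smooth_compose[OF fs \<psi>(1,2)]] by blast
qed

section \<open>Holomorphic self-maps of the disc\<close>

lemma unimodular_mult_cnj: "norm p = 1 \<Longrightarrow> p * cnj p = 1"
  using complex_norm_square[of p] by simp

lemma norm_one_minus_cnj_mult:
  fixes a z :: complex
  shows "(norm (1 - cnj a * z))\<^sup>2 - (norm (z - a))\<^sup>2 = (1 - (norm a)\<^sup>2) * (1 - (norm z)\<^sup>2)"
  unfolding cmod_power2 by (simp add: algebra_simps power2_eq_square)

lemma one_minus_cnj_mult_neq_0: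
  fixes a z :: complex
  assumes "norm a < 1" "norm z \<le> 1"
  shows "1 - cnj a * z \<noteq> 0"
proof
  assume "1 - cnj a * z = 0"
  hence "norm (cnj a * z) = 1" by simp
  moreover have "norm (cnj a * z) \<le> norm a" using assms by (simp add: norm_mult mult_left_le)
  ultimately show False using assms by simp
qed

lemma Schwarz_Pick:
  assumes f: "f holomorphic_on ball 0 1" "f ` ball 0 1 \<subseteq> ball 0 1"
    and az: "norm a < 1" "norm z < 1"
  shows "norm (f z - f a) * norm (1 - cnj a * z) \<le> norm (z - a) * norm (1 - cnj (f a) * f z)"
proof -
  let ?m = "Moebius_function 0"
  have fb: "norm (f w) < 1" if "norm w < 1" for w
    using f(2) that by (metis image_subset_iff mem_ball_0)
  define F where "F = ?m (f a) \<circ> (f \<circ> ?m (- a))"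
  have im: "?m (- a) ` ball 0 1 \<subseteq> ball 0 1"
    using az Moebius_function_norm_lt_1[of "- a"] by auto
  have "f \<circ> ?m (- a) holomorphic_on ball 0 1"
    by (rule holomorphic_on_compose_gen[OF Moebius_function_holomorphic f(1) im]) (use az in simp)
  moreover have "(f \<circ> ?m (- a)) ` ball 0 1 \<subseteq> ball 0 1" using im f(2) by force
  moreover have "?m (f a) holomorphic_on ball 0 1"
    by (rule Moebius_function_holomorphic) (rule fb[OF az(1)])
  ultimately have "F holomorphic_on ball 0 1" unfolding F_def by (metis holomorphic_on_compose_gen)
  moreover have "F 0 = 0"
    by (simp add: F_def Moebius_function_of_zero Moebius_function_eq_zero)
  moreover have "norm (F w) < 1" if "norm w < 1" for w
    unfolding F_def o_def
    by (intro Moebius_function_norm_lt_1 fb) (use az that in auto)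
  ultimately have "norm (F (?m a z)) \<le> norm (?m a z)"
    by (intro Schwarz_Lemma(1) Moebius_function_norm_lt_1 az)
  moreover have "F (?m a z) = ?m (f a) (f z)"
    using Moebius_function_compose[of "- a" a z] az by (simp add: F_def)
  ultimately have "norm (f z - f a) / norm (1 - cnj (f a) * f z) \<le> norm (z - a) / norm (1 - cnj a * z)"
    by (simp add: Moebius_function_simple norm_divide)
  moreover have "norm (1 - cnj (f a) * f z) > 0" "norm (1 - cnj a * z) > 0"
    using one_minus_cnj_mult_neq_0[of a z] one_minus_cnj_mult_neq_0[of "f a" "f z"] fb az
    by (auto simp: less_imp_le)
  ultimately show ?thesis by (simp add: divide_simps)
qed

text \<open>Schwarz--Pick rewritten with \<open>norm_one_minus_cnj_mult\<close>. In this form the factor \<open>1 - |a|\<^sup>2\<close> cancels when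
  \<open>f a = a\<close>, which allows \<open>a\<close> to tend to the boundary.\<close>

lemma Schwarz_Pick_weights:
  assumes f: "f holomorphic_on ball 0 1" "f ` ball 0 1 \<subseteq> ball 0 1"
    and az: "norm a < 1" "norm z < 1"
  shows "(1 - (norm a)\<^sup>2) * (1 - (norm z)\<^sup>2) * (norm (1 - cnj (f a) * f z))\<^sup>2
    \<le> (1 - (norm (f a))\<^sup>2) * (1 - (norm (f z))\<^sup>2) * (norm (1 - cnj a * z))\<^sup>2"
proof -
  have "(norm (f z - f a))\<^sup>2 * (norm (1 - cnj a * z))\<^sup>2 \<le> (norm (z - a))\<^sup>2 * (norm (1 - cnj (f a) * f z))\<^sup>2"
    using power_mono[OF Schwarz_Pick[OF assms], of 2] by (simp add: power_mult_distrib)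
  thus ?thesis
    unfolding norm_one_minus_cnj_mult[symmetric] by (simp add: algebra_simps)
qed

text \<open>The next two lemmas are the Hopf lemma and the strong maximum principle for the positive harmonic
  function \<open>Re H\<close>, read off from Schwarz--Pick for \<open>(H - 1) / (H + 1)\<close>.\<close>

lemma positive_real_part_lower_bound:
  assumes H: "H holomorphic_on ball 0 1" "\<And>z. z \<in> ball 0 1 \<Longrightarrow> 0 < Re (H z)"
  obtains c where "0 < c" "\<And>z. z \<in> ball 0 1 \<Longrightarrow> c * (1 - (norm z)\<^sup>2) \<le> Re (H z)"
proof -
  have nz: "H z + 1 \<noteq> 0" if "z \<in> ball 0 1" for z
    using H(2)[OF that] by (auto simp: complex_eq_iff)
  define h where "h z = (H z - 1) / (H z + 1)" for z
  have hh: "h holomorphic_on ball 0 1"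
    unfolding h_def by (intro holomorphic_intros H nz)
  have key: "1 - (norm (h z))\<^sup>2 = 4 * Re (H z) / (norm (H z + 1))\<^sup>2" if z: "z \<in> ball 0 1" for z
  proof -
    have "(norm (H z + 1))\<^sup>2 - (norm (H z - 1))\<^sup>2 = 4 * Re (H z)"
      unfolding cmod_power2 by (simp add: algebra_simps power2_eq_square)
    thus ?thesis using nz[OF z] by (simp add: h_def norm_divide power_divide divide_simps)
  qed
  have hb: "norm (h z) < 1" if z: "z \<in> ball 0 1" for z
  proof -
    have "0 < 1 - (norm (h z))\<^sup>2" unfolding key[OF z] using H(2)[OF z] nz[OF z] by simp
    thus ?thesis by (simp add: power_less_one_iff abs_square_less_1)
  qed
  define c where "c = (1 - norm (h 0))\<^sup>2 / 4"
  have h0: "norm (h 0) < 1" using hb by simp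
  have "c * (1 - (norm z)\<^sup>2) \<le> Re (H z)" if z: "z \<in> ball 0 1" for z
  proof -
    have 1: "(1 - (norm z)\<^sup>2) * (norm (1 - cnj (h 0) * h z))\<^sup>2 \<le> 1 - (norm (h z))\<^sup>2"
    proof -
      have im: "h ` ball 0 1 \<subseteq> ball 0 1" using hb by auto
      have "(1 - (norm (0::complex))\<^sup>2) * (1 - (norm z)\<^sup>2) * (norm (1 - cnj (h 0) * h z))\<^sup>2
          \<le> (1 - (norm (h 0))\<^sup>2) * (1 - (norm (h z))\<^sup>2) * (norm (1 - cnj 0 * z))\<^sup>2"
        by (rule Schwarz_Pick_weights[OF hh im]) (use z in auto)
      also have "\<dots> = (1 - (norm (h 0))\<^sup>2) * (1 - (norm (h z))\<^sup>2)" by simp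
      also have "\<dots> \<le> 1 * (1 - (norm (h z))\<^sup>2)"
        using hb[OF z] by (intro mult_right_mono) (simp_all add: power_le_one)
      finally show ?thesis by simp
    qed
    have "norm (cnj (h 0) * h z) \<le> norm (h 0)"
      using hb[OF z] by (simp add: norm_mult mult_left_le)
    hence "1 - norm (h 0) \<le> norm (1 - cnj (h 0) * h z)"
      using norm_triangle_ineq2[of 1 "cnj (h 0) * h z"] by simp
    hence "(1 - norm (h 0))\<^sup>2 \<le> (norm (1 - cnj (h 0) * h z))\<^sup>2"
      using h0 by (intro power_mono) auto
    moreover have "0 \<le> 1 - (norm z)\<^sup>2" using z by (simp add: power_le_one)
    ultimately have "(1 - (norm z)\<^sup>2) * (1 - norm (h 0))\<^sup>2 \<le> (1 - (norm z)\<^sup>2) * (norm (1 - cnj (h 0) * h z))\<^sup>2"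
      by (rule mult_left_mono)
    also note 1
    also have "1 - (norm (h z))\<^sup>2 \<le> 4 * Re (H z)"
    proof -
      have "1 \<le> norm (H z + 1)"
        using complex_Re_le_cmod[of "H z + 1"] H(2)[OF z] by simp
      hence "1 \<le> (norm (H z + 1))\<^sup>2" by (simp add: one_le_power)
      thus ?thesis unfolding key[OF z] using H(2)[OF z]
        by (simp add: divide_le_eq mult_le_cancel_left1)
    qed
    finally show ?thesis by (simp add: c_def mult.commute)
  qed
  thus thesis using that[of c] h0 by (simp add: c_def)
qed

lemma nonneg_real_part_constant:
  assumes H: "H holomorphic_on ball 0 1" "\<And>z. z \<in> ball 0 1 \<Longrightarrow> 0 \<le> Re (H z)"
    and w: "w \<in> ball 0 1" "Re (H w) = 0" and z: "z \<in> ball 0 1"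
  shows "H z = H w"
proof -
  have nz: "H z + 1 \<noteq> 0" if "z \<in> ball 0 1" for z
    using H(2)[OF that] by (auto simp: complex_eq_iff)
  define h where "h z = (H z - 1) / (H z + 1)" for z
  have hh: "h holomorphic_on ball 0 1"
    unfolding h_def by (intro holomorphic_intros H nz)
  have sq: "(norm (H z + 1))\<^sup>2 - (norm (H z - 1))\<^sup>2 = 4 * Re (H z)" for z
    unfolding cmod_power2 by (simp add: algebra_simps power2_eq_square)
  have "norm (h z) \<le> norm (h w)" if z: "z \<in> ball 0 1" for z
  proof -
    have "(norm (H z - 1))\<^sup>2 \<le> (norm (H z + 1))\<^sup>2" using sq[of z] H(2)[OF z] by linarith
    hence "norm (H z - 1) \<le> norm (H z + 1)" by (rule power2_le_imp_le) simp
    hence "norm (h z) \<le> 1" using nz[OF z] by (simp add: h_def norm_divide)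
    moreover have "(norm (H w - 1))\<^sup>2 = (norm (H w + 1))\<^sup>2" using sq[of w] w by linarith
    hence "norm (H w - 1) = norm (H w + 1)" by (simp add: power2_eq_iff_nonneg)
    hence "norm (h w) = 1" using nz[OF w(1)] by (simp add: h_def norm_divide)
    ultimately show ?thesis by simp
  qed
  hence "h constant_on ball 0 1"
    by (intro maximum_modulus_principle[OF hh, of "ball 0 1" w] w) auto
  hence "h z = h w" using z w(1) unfolding constant_on_def by metis
  hence "(H z - 1) * (H w + 1) = (H w - 1) * (H z + 1)"
    using nz[OF z] nz[OF w(1)] by (simp add: h_def divide_simps)
  thus ?thesis by (simp add: algebra_simps)
qed

lemma self_map_interior_cases:
  assumes f: "f holomorphic_on ball 0 1" "f ` ball 0 1 \<subseteq> cball 0 1"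
  obtains "f ` ball 0 1 \<subseteq> ball 0 1" | c where "norm c = 1" "\<And>z. z \<in> ball 0 1 \<Longrightarrow> f z = c"
proof (cases "f ` ball 0 1 \<subseteq> ball 0 1")
  case False
  then obtain w where w: "w \<in> ball 0 1" "f w \<notin> ball 0 1" by blast
  have le: "norm (f z) \<le> 1" if "z \<in> ball 0 1" for z
    using f(2) that by (metis image_subset_iff mem_cball_0)
  have nw: "norm (f w) = 1" using le[OF w(1)] w(2) by simp
  have "f constant_on ball 0 1"
    by (rule maximum_modulus_principle[OF f(1), of "ball 0 1" w]) (use w le nw in auto)
  hence "f z = f w" if "z \<in> ball 0 1" for z using w(1) that unfolding constant_on_def by metis
  thus thesis using nw that(2) by blast
qed (use that in blast)

text \<open>Wolff's lemma: without interior fixed points, all horodiscs at some boundary fixed point are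
  invariant. The point is a limit of fixed points of the maps \<open>r \<phi>\<close>, \<open>r \<rightarrow> 1\<close>, to which Schwarz--Pick applies.\<close>

lemma Wolff_point:
  assumes hol: "\<phi> holomorphic_on ball 0 1" and cont: "continuous_on (cball 0 1) \<phi>"
    and self: "\<phi> ` cball 0 1 \<subseteq> cball 0 1"
    and nofix: "\<And>z. z \<in> ball 0 1 \<Longrightarrow> \<phi> z \<noteq> z"
  obtains p where "norm p = 1" "\<phi> p = p"
    "\<And>z. z \<in> ball 0 1 \<Longrightarrow> (1 - (norm z)\<^sup>2) * (norm (p - \<phi> z))\<^sup>2 \<le> (1 - (norm (\<phi> z))\<^sup>2) * (norm (p - z))\<^sup>2"
proof -
  define r where "r n = 1 - inverse (real (Suc n))" for n
  have r: "0 \<le> r n" "r n < 1" for n by (auto simp: r_def divide_simps)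
  have rlim: "r \<longlonglongrightarrow> 1"
    unfolding r_def using tendsto_diff[OF tendsto_const LIMSEQ_inverse_real_of_nat, of 1] by simp
  have le: "norm (\<phi> z) \<le> 1" if "z \<in> cball 0 1" for z
    using self that by (metis image_subset_iff mem_cball_0)
  have small: "norm (r n * \<phi> z) < 1" if "z \<in> cball 0 1" for n z
  proof -
    have "norm (r n * \<phi> z) \<le> r n" using le[OF that] r[of n] by (simp add: norm_mult mult_left_le)
    thus ?thesis using r(2)[of n] by simp
  qed
  have "\<exists>a\<in>cball 0 1. r n * \<phi> a = a" for n
  proof -
    have c: "continuous_on (cball 0 1) (\<lambda>z. r n * \<phi> z)" by (intro continuous_intros cont)
    have m: "(\<lambda>z. r n * \<phi> z) \<in> cball 0 1 \<rightarrow> cball 0 1" using small[of _ n]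
      by (intro Pi_I) (simp add: less_imp_le)
    have "cball (0::complex) 1 \<noteq> {}" by simp
    from brouwer[OF compact_cball convex_cball this c m] show ?thesis by blast
  qed
  then obtain a where a: "\<And>n. a n \<in> cball 0 1" "\<And>n. r n * \<phi> (a n) = a n" by metis
  have a1: "norm (a n) < 1" for n using small[OF a(1)[of n], of n] unfolding a(2) .
  obtain p s where ps: "p \<in> cball 0 1" "strict_mono s" "(a \<circ> s) \<longlonglongrightarrow> p"
    using compact_cball a(1) unfolding compact_def by metis
  have rs: "(\<lambda>n. r (s n)) \<longlonglongrightarrow> 1" using LIMSEQ_subseq_LIMSEQ[OF rlim ps(2)] by (simp add: o_def)
  have as: "(\<lambda>n. a (s n)) \<longlonglongrightarrow> p" using ps(3) by (simp add: o_def)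
  have "(\<lambda>n. \<phi> (a (s n))) \<longlonglongrightarrow> \<phi> p"
    by (rule continuous_on_tendsto_compose[OF cont as ps(1)]) (use a in auto)
  hence "(\<lambda>n. complex_of_real (r (s n)) * \<phi> (a (s n))) \<longlonglongrightarrow> of_real 1 * \<phi> p"
    by (intro tendsto_intros rs)
  hence "(\<lambda>n. a (s n)) \<longlonglongrightarrow> \<phi> p" by (simp add: a(2))
  hence fixp: "\<phi> p = p" using as LIMSEQ_unique by blast
  have p1: "norm p = 1"
    using nofix[of p] fixp ps(1) by (cases "norm p < 1") auto
  have julia: "(1 - (norm z)\<^sup>2) * (norm (p - \<phi> z))\<^sup>2 \<le> (1 - (norm (\<phi> z))\<^sup>2) * (norm (p - z))\<^sup>2"
    if z: "z \<in> ball 0 1" for z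
  proof -
    have approx: "(1 - (norm z)\<^sup>2) * (norm (1 - cnj (a n) * (r n * \<phi> z)))\<^sup>2
      \<le> (1 - (norm (r n * \<phi> z))\<^sup>2) * (norm (1 - cnj (a n) * z))\<^sup>2" for n
    proof -
      have "(1 - (norm (a n))\<^sup>2) * (1 - (norm z)\<^sup>2) * (norm (1 - cnj (r n * \<phi> (a n)) * (r n * \<phi> z)))\<^sup>2
          \<le> (1 - (norm (r n * \<phi> (a n)))\<^sup>2) * (1 - (norm (r n * \<phi> z))\<^sup>2) * (norm (1 - cnj (a n) * z))\<^sup>2"
        by (rule Schwarz_Pick_weights[where f = "\<lambda>z. r n * \<phi> z"])
          (use z a1 small[of _ n] in \<open>auto intro!: holomorphic_intros hol\<close>)
      moreover have "0 < 1 - (norm (a n))\<^sup>2" using a1 by (simp add: power_less_one_iff abs_square_less_1)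
      ultimately show ?thesis unfolding a(2) mult.assoc by (simp only: mult_le_cancel_left_pos)
    qed
    have "(\<lambda>n. (1 - (norm z)\<^sup>2) * (norm (1 - cnj (a (s n)) * (r (s n) * \<phi> z)))\<^sup>2)
        \<longlonglongrightarrow> (1 - (norm z)\<^sup>2) * (norm (1 - cnj p * (of_real 1 * \<phi> z)))\<^sup>2"
      by (intro tendsto_intros as rs)
    moreover have "(\<lambda>n. (1 - (norm (r (s n) * \<phi> z))\<^sup>2) * (norm (1 - cnj (a (s n)) * z))\<^sup>2)
        \<longlonglongrightarrow> (1 - (norm (of_real 1 * \<phi> z))\<^sup>2) * (norm (1 - cnj p * z))\<^sup>2"
      by (intro tendsto_intros as rs)
    ultimately have "(1 - (norm z)\<^sup>2) * (norm (1 - cnj p * \<phi> z))\<^sup>2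
        \<le> (1 - (norm (\<phi> z))\<^sup>2) * (norm (1 - cnj p * z))\<^sup>2"
      using approx LIMSEQ_le by fastforce
    moreover have "norm (1 - cnj p * w) = norm (p - w)" for w
    proof -
      have "cnj p * p = 1" using unimodular_mult_cnj[OF p1] by (simp add: mult.commute)
      hence "1 - cnj p * w = cnj p * (p - w)" by (simp add: algebra_simps)
      thus ?thesis using p1 by (simp add: norm_mult)
    qed
    ultimately show ?thesis by simp
  qed
  show thesis by (rule that[OF p1 fixp julia])
qed

section \<open>Derivatives at boundary fixed points\<close>

text \<open>Where a self-map of the disc, differentiable up to the boundary, touches the circle, its derivative takes
  the outward normal to a nonnegative multiple of the outward normal.\<close>

lemma boundary_derivative_real_nonneg:
  assumes self: "f ` cball 0 1 \<subseteq> cball 0 1"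
    and d: "(f has_field_derivative d) (at w within cball 0 1)"
    and w: "norm w = 1" "norm (f w) = 1"
  shows "Im (d * w * cnj (f w)) = 0" and "0 \<le> Re (d * w * cnj (f w))"
proof -
  define e where "e = d * w * cnj (f w)"
  have fw: "f w * cnj (f w) = 1" by (rule unimodular_mult_cnj[OF w(2)])
  \<comment> \<open>Differentiate \<open>Re (f (w (1 + t v)) cnj (f w)) \<le> 1\<close> at \<open>t = 0\<close> in a direction \<open>v\<close> pointing into the disc.\<close>
  \<comment> \<open>All slopes \<open>s\<close> are needed: together they bound \<open>Re e\<close> from below and force \<open>Im e = 0\<close>.\<close>
  have dir: "Re (e * Complex (-1) s) \<le> 0" for s
  proof -
    define v where "v = Complex (-1) s"
    define h where "h t = Re (f (w * (1 + of_real t * v)) * cnj (f w))" for t :: real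
    define T where "T = 2 / (1 + s\<^sup>2)"
    have T: "0 < T" unfolding T_def by (simp add: add_pos_nonneg)
    have inside: "w * (1 + of_real t * v) \<in> cball 0 1" if "t \<in> {0..T}" for t
    proof -
      have "t * (1 + s\<^sup>2) \<le> 2" using that unfolding T_def by (simp add: pos_le_divide_eq add_pos_nonneg)
      hence "t * (t * (1 + s\<^sup>2)) \<le> t * 2" using that by (intro mult_left_mono) auto
      moreover have "(norm (1 + of_real t * v))\<^sup>2 = 1 - 2 * t + t * (t * (1 + s\<^sup>2))"
        unfolding cmod_power2 v_def by (simp add: power2_eq_square algebra_simps)
      ultimately have "(norm (1 + of_real t * v))\<^sup>2 \<le> 1\<^sup>2" by simp
      hence "norm (1 + of_real t * v) \<le> 1" by (rule power2_le_imp_le) simp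
      thus ?thesis using w by (simp add: norm_mult)
    qed
    have h1: "h t \<le> h 0" if "t \<in> {0..T}" for t
    proof -
      have "norm (f (w * (1 + of_real t * v))) \<le> 1"
        using self inside[OF that] by (metis image_subset_iff mem_cball_0)
      hence "norm (f (w * (1 + of_real t * v)) * cnj (f w)) \<le> 1" using w by (simp add: norm_mult)
      hence "h t \<le> 1" unfolding h_def using complex_Re_le_cmod order_trans by blast
      thus ?thesis using fw by (simp add: h_def)
    qed
    have "((\<lambda>t. w * (1 + of_real t * v)) has_vector_derivative w * v) (at 0 within {0..T})"
      by (auto intro!: derivative_eq_intros simp: has_vector_derivative_def scaleR_conv_of_real mult_ac)
    moreover have "(f has_field_derivative d) (at (w * (1 + of_real 0 * v)) within (\<lambda>t. w * (1 + of_real t * v)) ` {0..T})"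
      by (rule DERIV_subset[OF _ image_subsetI[OF inside]]) (use d in simp)
    ultimately have "(f \<circ> (\<lambda>t. w * (1 + of_real t * v)) has_vector_derivative w * v * d) (at 0 within {0..T})"
      by (rule field_vector_diff_chain_within)
    hence "((\<lambda>t. f (w * (1 + of_real t * v)) * cnj (f w)) has_vector_derivative w * v * d * cnj (f w)) (at 0 within {0..T})"
      unfolding o_def by (rule has_vector_derivative_mult_left)
    hence "(h has_vector_derivative Re (w * v * d * cnj (f w))) (at 0 within {0..T})"
      unfolding h_def[abs_def] by (rule bounded_linear.has_vector_derivative[OF bounded_linear_Re])
    hence "(h has_real_derivative Re (e * v)) (at 0 within {0..T})"
      by (simp add: has_real_derivative_iff_has_vector_derivative e_def mult_ac)
    hence "((\<lambda>t. (h t - h 0) / (t - 0)) \<longlongrightarrow> Re (e * v)) (at 0 within {0..T})"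
      by (simp add: has_field_derivative_iff)
    moreover have "\<forall>\<^sub>F t in at 0 within {0..T}. (h t - h 0) / (t - 0) \<le> 0"
      unfolding eventually_at_filter using h1
        by (auto intro!: always_eventually simp: divide_nonpos_nonneg)
    moreover have "at (0::real) within {0..T} \<noteq> bot" using T by (simp add: at_within_Icc_at_right)
    ultimately show ?thesis unfolding v_def by (intro tendsto_upperbound)
  qed
  have 0: "- Re e - s * Im e \<le> 0" for s using dir[of s] by (simp add: mult.commute)
  have "Im e = 0"
  proof (rule ccontr)
    assume "Im e \<noteq> 0"
    hence "- Re e - (- (Re e + 1) / Im e) * Im e = 1" by simp
    thus False using 0[of "- (Re e + 1) / Im e"] by linarith
  qed
  thus "Im (d * w * cnj (f w)) = 0" "0 \<le> Re (d * w * cnj (f w))"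
    using 0[of 0] by (auto simp: e_def)
qed

lemma Re_Cayley:
  assumes "norm p = 1" "z \<noteq> p"
  shows "Re ((p + z) / (p - z)) = (1 - (norm z)\<^sup>2) / (norm (p - z))\<^sup>2"
proof -
  have "Re ((p + z) * cnj (p - z)) = (norm p)\<^sup>2 - (norm z)\<^sup>2"
    unfolding cmod_power2 by (simp add: algebra_simps power2_eq_square)
  moreover have "(p + z) / (p - z) = ((p + z) * cnj (p - z)) / of_real ((norm (p - z))\<^sup>2)"
    by (subst complex_div_cnj) (simp only: of_real_power)
  ultimately show ?thesis using assms(1) by (simp only: Re_divide_of_real) simp
qed

lemma Cayley_inj:
  fixes p z w :: complex
  assumes "(p + z) / (p - z) = (p + w) / (p - w)" "z \<noteq> p" "w \<noteq> p" "p \<noteq> 0"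
  shows "z = w"
proof -
  have "(p + z) * (p - w) = (p + w) * (p - z)" using assms by (simp add: divide_simps)
  hence "2 * (p * (z - w)) = 0" by (simp add: algebra_simps)
  thus ?thesis using assms(4) by simp
qed

text \<open>In the coordinate \<open>C z = (p + z) / (p - z)\<close>, whose real part is the Poisson kernel at \<open>p\<close>, the hypothesis
  \<open>julia\<close> says that \<open>H = C \<circ> f - C\<close> has nonnegative real part. It vanishes at \<open>w\<close>, so by the Hopf lemma it grows
  linearly along the radius into the disc (unless \<open>H = 0\<close> and \<open>f\<close> is the identity), and this excess is what makes
  \<open>|d|\<close> exceed \<open>1\<close>.\<close>

lemma repelling_boundary_fixpoint:
  assumes hol: "f holomorphic_on ball 0 1" and self: "f ` ball 0 1 \<subseteq> ball 0 1"
    and p: "norm p = 1"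
    and julia: "\<And>z. z \<in> ball 0 1 \<Longrightarrow> (1 - (norm z)\<^sup>2) * (norm (p - f z))\<^sup>2 \<le> (1 - (norm (f z))\<^sup>2) * (norm (p - z))\<^sup>2"
    and w: "norm w = 1" "w \<noteq> p" "f w = w" "(f has_field_derivative d) (at w within cball 0 1)"
    and not_id: "\<exists>z\<in>ball 0 1. f z \<noteq> z"
  shows "1 < norm d"
proof -
  define C where "C z = (p + z) / (p - z)" for z
  define H where "H z = C (f z) - C z" for z
  have fb: "norm (f z) < 1" if "z \<in> ball 0 1" for z using self that
    by (metis image_subset_iff mem_ball_0)
  have np: "z \<noteq> p" "f z \<noteq> p" if "z \<in> ball 0 1" for z using fb[OF that] that p by auto
  have H: "H holomorphic_on ball 0 1"
    unfolding H_def C_def using np by (intro holomorphic_intros hol) (metis right_minus_eq)+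
  have ReH: "Re (H z) = (1 - (norm (f z))\<^sup>2) / (norm (p - f z))\<^sup>2 - (1 - (norm z)\<^sup>2) / (norm (p - z))\<^sup>2"
    if "z \<in> ball 0 1" for z
    unfolding H_def C_def using np[OF that] by (simp add: Re_Cayley p)
  have pos: "0 < (norm (p - f z))\<^sup>2" "0 < (norm (p - z))\<^sup>2" if "z \<in> ball 0 1" for z using np[OF that]
    by auto
  have H0: "0 \<le> Re (H z)" if "z \<in> ball 0 1" for z
    unfolding ReH[OF that] using julia[OF that] pos[OF that] by (simp add: divide_simps mult.commute)
  \<comment> \<open>The radial approach to \<open>w\<close>.\<close>
  define z where "z r = complex_of_real r * w" for r
  have zb: "z r \<in> ball 0 1" if "r \<in> {0<..<1}" for r using that w by (simp add: z_def norm_mult)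
  have ev: "\<forall>\<^sub>F r in at_left 1. r \<in> {0<..<1::real}"
    by (rule eventually_at_leftI[of 0]) auto
  have zl: "(z \<longlongrightarrow> w) (at_left 1)" unfolding z_def by (auto intro!: tendsto_eq_intros)
  have "filterlim z (at w within cball 0 1) (at_left 1)"
    unfolding filterlim_at using zl
  proof (intro conjI)
    show "\<forall>\<^sub>F r in at_left 1. z r \<in> cball 0 1 \<and> z r \<noteq> w"
      using ev by eventually_elim (use zb w in \<open>force simp: z_def norm_mult\<close>)
  qed
  hence quot: "((\<lambda>r. (f (z r) - f w) / (z r - w)) \<longlongrightarrow> d) (at_left 1)"
    using w(4) unfolding has_field_derivative_iff by (rule filterlim_compose[rotated])
  have fl: "((\<lambda>r. f (z r)) \<longlongrightarrow> w) (at_left 1)"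
  proof -
    have "((\<lambda>r. (f (z r) - f w) / (z r - w) * (z r - w) + w) \<longlongrightarrow> d * (w - w) + w) (at_left 1)"
      by (intro tendsto_intros quot zl)
    moreover have "\<forall>\<^sub>F r in at_left 1. (f (z r) - f w) / (z r - w) * (z r - w) + w = f (z r)"
      using ev by eventually_elim (use w in \<open>auto simp: z_def\<close>)
    ultimately show ?thesis using tendsto_cong by fastforce
  qed
  have Rp: "0 < Re (H x)" if x: "x \<in> ball 0 1" for x
  proof (rule ccontr)
    assume "\<not> 0 < Re (H x)"
    hence Re0: "Re (H x) = 0" using H0[OF x] by simp
    have const: "H y = H x" if "y \<in> ball 0 1" for y
      by (rule nonneg_real_part_constant[OF H _ x Re0 that]) (rule H0)
    have "((\<lambda>r. H (z r)) \<longlongrightarrow> C w - C w) (at_left 1)"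
      unfolding H_def C_def using w(2) by (intro tendsto_intros fl zl) auto
    moreover have "\<forall>\<^sub>F r in at_left 1. H (z r) = H x"
      using ev by eventually_elim (use zb const in blast)
    ultimately have "((\<lambda>r::real. H x) \<longlongrightarrow> 0) (at_left 1)" using tendsto_cong by fastforce
    hence Hx: "H x = 0" using tendsto_const tendsto_unique by (metis trivial_limit_at_left_real)
    have "f y = y" if "y \<in> ball 0 1" for y
    proof (rule Cayley_inj[of p])
      show "(p + f y) / (p - f y) = (p + y) / (p - y)"
        using const[OF that] Hx by (simp add: H_def C_def)
    qed (use np[OF that] p in auto)
    thus False using not_id by blast
  qed
  obtain c where c: "0 < c" "\<And>z. z \<in> ball 0 1 \<Longrightarrow> c * (1 - (norm z)\<^sup>2) \<le> Re (H z)"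
    using positive_real_part_lower_bound[OF H Rp] by blast
  have le: "\<forall>\<^sub>F r in at_left 1. (norm (p - f (z r)))\<^sup>2 * (1 / (norm (p - z r))\<^sup>2 + c)
      \<le> norm ((f (z r) - f w) / (z r - w)) * (2 / (1 + r))"
    using ev
  proof eventually_elim
    case (elim r)
    have zr: "z r \<in> ball 0 1" by (rule zb[OF elim])
    have nz: "norm (z r) = r" using elim w by (simp add: z_def norm_mult)
    have r: "0 < 1 - r" "0 < 1 + r" "0 < 1 - r\<^sup>2" using elim by (auto simp: power_less_one_iff)
    have "(1 - r\<^sup>2) * (1 / (norm (p - z r))\<^sup>2 + c) \<le> (1 - (norm (f (z r)))\<^sup>2) / (norm (p - f (z r)))\<^sup>2"
      using c(2)[OF zr] unfolding ReH[OF zr] nz by (simp add: algebra_simps)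
    hence "(1 - r\<^sup>2) * (1 / (norm (p - z r))\<^sup>2 + c) * (norm (p - f (z r)))\<^sup>2 \<le> 1 - (norm (f (z r)))\<^sup>2"
      using pos(1)[OF zr] by (simp add: pos_le_divide_eq)
    also have "1 - (norm (f (z r)))\<^sup>2 = (1 - norm (f (z r))) * (1 + norm (f (z r)))"
      by (simp add: algebra_simps power2_eq_square)
    also have "\<dots> \<le> norm (f (z r) - f w) * 2"
    proof (rule mult_mono)
      show "1 - norm (f (z r)) \<le> norm (f (z r) - f w)"
        using norm_triangle_ineq2[of "f w" "f (z r)"] w by (simp add: norm_minus_commute)
    qed (use fb[OF zr] in auto)
    finally have *: "(1 - r\<^sup>2) * ((norm (p - f (z r)))\<^sup>2 * (1 / (norm (p - z r))\<^sup>2 + c)) \<le> norm (f (z r) - f w) * 2"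
      by (simp add: mult_ac)
    have "norm (z r - w) = 1 - r"
    proof -
      have "z r - w = - (of_real (1 - r) * w)" by (simp add: z_def algebra_simps)
      thus ?thesis using elim w by (simp only: norm_minus_cancel norm_mult norm_of_real) simp
    qed
    moreover have "1 - r\<^sup>2 = (1 - r) * (1 + r)" by (simp add: algebra_simps power2_eq_square)
    ultimately have "norm ((f (z r) - f w) / (z r - w)) * (2 / (1 + r)) = norm (f (z r) - f w) * 2 / (1 - r\<^sup>2)"
      by (simp add: norm_divide)
    thus ?case using * r by (simp add: pos_le_divide_eq mult_ac)
  qed
  have "((\<lambda>r. (norm (p - f (z r)))\<^sup>2 * (1 / (norm (p - z r))\<^sup>2 + c)) \<longlongrightarrow>
      (norm (p - w))\<^sup>2 * (1 / (norm (p - w))\<^sup>2 + c)) (at_left 1)"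
    using w(2) by (intro tendsto_intros fl zl) auto
  moreover have "((\<lambda>r. norm ((f (z r) - f w) / (z r - w)) * (2 / (1 + r))) \<longlongrightarrow> norm d * (2 / (1 + 1))) (at_left 1)"
    by (intro tendsto_intros quot) auto
  ultimately have "(norm (p - w))\<^sup>2 * (1 / (norm (p - w))\<^sup>2 + c) \<le> norm d * (2 / (1 + 1))"
    using tendsto_le[OF trivial_limit_at_left_real] le by blast
  moreover have "(norm (p - w))\<^sup>2 * (1 / (norm (p - w))\<^sup>2 + c) = 1 + c * (norm (p - w))\<^sup>2"
    using w(2) by (simp add: algebra_simps)
  moreover have "0 < c * (norm (p - w))\<^sup>2" using c w(2) by simp
  ultimately show ?thesis by simp
qed

lemma funpow_ball:
  assumes "\<phi> ` S \<subseteq> S" "z \<in> S"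
  shows "(\<phi> ^^ n) z \<in> S"
  using assms by (induction n) auto

lemma holomorphic_on_funpow:
  assumes "\<phi> holomorphic_on S" "\<phi> ` S \<subseteq> S"
  shows "\<phi> ^^ n holomorphic_on S"
proof (induction n)
  case (Suc n)
  have "\<phi> \<circ> \<phi> ^^ n holomorphic_on S"
    by (rule holomorphic_on_compose_gen[OF Suc assms(1)]) (use funpow_ball[OF assms(2)] in blast)
  thus ?case by (simp only: funpow.simps)
qed (simp add: id_def)

text \<open>Every boundary fixed point of an iterate \<open>\<phi>\<^sup>N\<close> other than the Wolff point \<open>p\<close> repels. The iterate is not
  the identity: otherwise \<open>Re ((p + z) / (p - z))\<close> would be constant along orbits, and \<open>\<phi>\<close> would be a
  translation in that half-plane coordinate, of finite order, hence the identity.\<close>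

lemma iterate_repelling_boundary_fixpoint:
  assumes hol: "\<phi> holomorphic_on ball 0 1" and self: "\<phi> ` ball 0 1 \<subseteq> ball 0 1"
    and nofix: "\<And>z. z \<in> ball 0 1 \<Longrightarrow> \<phi> z \<noteq> z"
    and p: "norm p = 1"
    and julia: "\<And>z. z \<in> ball 0 1 \<Longrightarrow> (1 - (norm z)\<^sup>2) * (norm (p - \<phi> z))\<^sup>2 \<le> (1 - (norm (\<phi> z))\<^sup>2) * (norm (p - z))\<^sup>2"
    and N: "0 < N"
    and w: "norm w = 1" "w \<noteq> p" "(\<phi> ^^ N) w = w" "(\<phi> ^^ N has_field_derivative d) (at w within cball 0 1)"
  shows "1 < norm d"
proof -
  define C where "C z = (p + z) / (p - z)" for z
  have itb: "(\<phi> ^^ n) z \<in> ball 0 1" if "z \<in> ball 0 1" for n z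
    using funpow_ball[OF self that] .
  have np: "z \<noteq> p" if "z \<in> ball 0 1" for z using that p by auto
  have CRe: "Re (C z) = (1 - (norm z)\<^sup>2) / (norm (p - z))\<^sup>2" if "z \<in> ball 0 1" for z
    unfolding C_def by (rule Re_Cayley[OF p np[OF that]])
  have incr: "Re (C z) \<le> Re (C (\<phi> z))" if z: "z \<in> ball 0 1" for z
  proof -
    have \<phi>z: "\<phi> z \<in> ball 0 1" using self z by blast
    have "0 < (norm (p - z))\<^sup>2" "0 < (norm (p - \<phi> z))\<^sup>2" using np z \<phi>z by auto
    thus ?thesis unfolding CRe[OF z] CRe[OF \<phi>z] using julia[OF z]
      by (simp add: divide_simps mult.commute)
  qed
  have mono: "Re (C ((\<phi> ^^ m) z)) \<le> Re (C ((\<phi> ^^ n) z))" if "m \<le> n" "z \<in> ball 0 1" for m n z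
    using that(1)
  proof (induction n rule: dec_induct)
    case (step n)
    thus ?case using incr[OF itb[OF that(2), of n]] by simp
  qed simp
  note ithol = holomorphic_on_funpow[OF hol self]
  have "\<exists>z\<in>ball 0 1. (\<phi> ^^ N) z \<noteq> z"
  proof (rule ccontr)
    assume "\<not> (\<exists>z\<in>ball 0 1. (\<phi> ^^ N) z \<noteq> z)"
    hence id: "(\<phi> ^^ N) z = z" if "z \<in> ball 0 1" for z using that by blast
    define H where "H z = C (\<phi> z) - C z" for z
    have \<phi>b: "\<phi> z \<in> ball 0 1" if "z \<in> ball 0 1" for z using self that by blast
    have Hh: "H holomorphic_on ball 0 1"
      unfolding H_def C_def using np \<phi>b by (intro holomorphic_intros hol) (metis right_minus_eq)+
    have H0: "0 \<le> Re (H z)" if "z \<in> ball 0 1" for z using incr[OF that] by (simp add: H_def)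
    have Re0: "Re (H 0) = 0"
      using mono[of 1 N 0] id[of 0] N H0[of 0] by (simp add: H_def)
    have const: "H z = H 0" if "z \<in> ball 0 1" for z
      by (rule nonneg_real_part_constant[OF Hh _ _ Re0 that]) (simp_all add: H0)
    have "C ((\<phi> ^^ n) 0) = C 0 + of_nat n * H 0" for n
    proof (induction n)
      case (Suc n)
      have "H ((\<phi> ^^ n) 0) = H 0" by (rule const[OF itb]) simp
      thus ?case using Suc by (simp add: H_def algebra_simps)
    qed simp
    from this[of N] have "H 0 = 0" using id[of 0] N by simp
    have "\<phi> 0 = 0"
    proof (rule Cayley_inj[of p])
      show "(p + \<phi> 0) / (p - \<phi> 0) = (p + 0) / (p - 0)"
        using \<open>H 0 = 0\<close> by (simp add: H_def C_def)
    qed (use np[OF \<phi>b[of 0]] p in auto)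
    thus False using nofix[of 0] by simp
  qed
  moreover have "(1 - (norm z)\<^sup>2) * (norm (p - (\<phi> ^^ N) z))\<^sup>2 \<le> (1 - (norm ((\<phi> ^^ N) z))\<^sup>2) * (norm (p - z))\<^sup>2"
    if z: "z \<in> ball 0 1" for z
  proof -
    have "0 < (norm (p - z))\<^sup>2" "0 < (norm (p - (\<phi> ^^ N) z))\<^sup>2" using np z itb[OF z, of N] by auto
    thus ?thesis using mono[of 0 N z] z unfolding CRe[OF itb[OF z]]
      by (simp add: CRe[OF z] divide_simps mult.commute)
  qed
  ultimately show ?thesis
    using itb by (intro repelling_boundary_fixpoint[OF ithol[of N] _ p _ w]) auto
qed

section \<open>Boundedness of composition operators\<close>

text \<open>The uniform boundedness principle for a family of seminorms \<open>P N\<close>, by a gliding hump. Completeness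
  enters only through \<open>series\<close>: an absolutely convergent series has a sum, for which the triangle
  inequality isolates any single term.\<close>

lemma gliding_hump:
  fixes nrm :: "'a \<Rightarrow> real" and P :: "nat \<Rightarrow> 'a \<Rightarrow> real" and K :: "nat \<Rightarrow> real"
  assumes nn: "\<And>x. x \<in> D \<Longrightarrow> 0 \<le> nrm x"
    and K: "\<And>N. 0 \<le> K N"
    and cont: "\<And>N x. x \<in> D \<Longrightarrow> P N x \<le> K N * nrm x"
    and scale: "\<And>x t. x \<in> D \<Longrightarrow> 0 < t \<Longrightarrow> \<exists>y\<in>D. nrm y = t * nrm x \<and> (\<forall>N. P N y = t * P N x)"
    and series: "\<And>x. (\<And>n::nat. x n \<in> D) \<Longrightarrow> summable (\<lambda>n. nrm (x n)) \<Longrightarrow>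
      \<exists>s\<in>D. \<forall>N k T. (\<forall>m. (\<Sum>j\<in>{k<..m}. P N (x j)) \<le> T) \<longrightarrow> P N (x k) \<le> P N s + (\<Sum>j<k. P N (x j)) + T"
    and bdd: "\<And>x. x \<in> D \<Longrightarrow> \<exists>B. \<forall>N. P N x \<le> B"
  shows "\<exists>C. \<forall>x\<in>D. \<forall>N. P N x \<le> C * nrm x"
proof (rule ccontr)
  assume "\<not> (\<exists>C. \<forall>x\<in>D. \<forall>N. P N x \<le> C * nrm x)"
  hence unb: "\<exists>x\<in>D. \<exists>N. C * nrm x < P N x" for C by (meson not_le)
  have hump: "\<exists>y\<in>D. \<exists>N. nrm y = t \<and> c < P N y" if t: "0 < t" for t c
  proof -
    obtain x N where x: "x \<in> D" "(c / t) * nrm x < P N x" using unb by blast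
    have "nrm x \<noteq> 0" using cont[OF x(1), of N] x(2) by auto
    hence pos: "0 < nrm x" using nn[OF x(1)] by simp
    obtain y where y: "y \<in> D" "nrm y = t / nrm x * nrm x" "\<And>N. P N y = t / nrm x * P N x"
      using scale[OF x(1), of "t / nrm x"] t pos by auto
    have "t / nrm x * ((c / t) * nrm x) < t / nrm x * P N x"
      using x(2) t pos by (intro mult_strict_left_mono) auto
    hence "c < P N y" using t pos unfolding y(3) by simp
    moreover have "nrm y = t" using y(2) pos by simp
    ultimately show ?thesis using y(1) by blast
  qed
  obtain B where B: "\<And>x N. x \<in> D \<Longrightarrow> P N x \<le> B x" using bdd by metis
  obtain Y I where YI: "\<And>t c. 0 < t \<Longrightarrow> Y t c \<in> D" "\<And>t c. 0 < t \<Longrightarrow> nrm (Y t c) = t"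
    "\<And>t c. 0 < t \<Longrightarrow> c < P (I t c) (Y t c)"
    using hump by metis
  \<comment> \<open>\<open>S n\<close> bounds the sum of the earlier humps and \<open>L n\<close> the constants \<open>K\<close> of their indices; the next hump
    has height above \<open>n + S n\<close> and norm \<open>1 / (2\<^sup>n (1 + L n))\<close>, so it is invisible to the earlier indices.\<close>
  define t where "t n L = (1 / 2) ^ n / (1 + L)" for n :: nat and L :: real
  define F where "F = rec_nat (0::real, 0::real)
    (\<lambda>n (S, L). (S + B (Y (t n L) (real n + S)), L + K (I (t n L) (real n + S))))"
  define S where "S n = fst (F n)" for n
  define L where "L n = snd (F n)" for n
  define y where "y n = Y (t n (L n)) (real n + S n)" for n
  define i where "i n = I (t n (L n)) (real n + S n)" for n
  have F0: "S 0 = 0" "L 0 = 0" by (simp_all add: S_def L_def F_def)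
  have FS: "S (Suc n) = S n + B (y n)" "L (Suc n) = L n + K (i n)" for n
    by (simp_all add: S_def L_def F_def y_def i_def split_beta)
  have S: "S n = (\<Sum>j<n. B (y j))" for n by (induction n) (simp_all add: F0 FS)
  have L: "L n = (\<Sum>j<n. K (i j))" for n by (induction n) (simp_all add: F0 FS)
  have L0: "0 \<le> L n" for n unfolding L by (intro sum_nonneg K)
  have t0: "0 < t n (L n)" for n using L0[of n] by (simp add: t_def add_pos_nonneg)
  have y: "y n \<in> D" "nrm (y n) = t n (L n)" "real n + S n < P (i n) (y n)" for n
    unfolding y_def i_def using YI[OF t0] by auto
  have "t n (L n) \<le> (1 / 2) ^ n" for n using L0[of n] by (simp add: t_def divide_le_eq)
  hence "norm (nrm (y n)) \<le> (1 / 2) ^ n" for n using t0[of n] unfolding y(2) by simp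
  moreover have "summable (\<lambda>n. (1 / 2 :: real) ^ n)" by (rule summable_geometric) simp
  ultimately have "summable (\<lambda>n. nrm (y n))" by (rule summable_comparison_test'[rotated])
  from series[OF y(1) this] obtain s where s: "s \<in> D"
    "\<And>N k T. (\<And>m. (\<Sum>j\<in>{k<..m}. P N (y j)) \<le> T) \<Longrightarrow> P N (y k) \<le> P N s + (\<Sum>j<k. P N (y j)) + T"
    by blast
  have later: "P (i k) (y j) \<le> (1 / 2) ^ j" if "k < j" for j k
  proof -
    have "K (i k) \<le> L j" unfolding L using that K by (intro member_le_sum) auto
    hence "K (i k) * nrm (y j) \<le> (1 + L j) * nrm (y j)"
      using nn[OF y(1)[of j]] by (intro mult_right_mono) auto
    also have "\<dots> = (1 / 2) ^ j" using L0[of j] by (simp add: y(2) t_def)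
    finally show ?thesis using cont[OF y(1), of "i k" j] by linarith
  qed
  have "real k \<le> B s + 2" for k
  proof -
    have "(\<Sum>j\<in>{k<..m}. P (i k) (y j)) \<le> 2" for m
    proof -
      have "(\<Sum>j\<in>{k<..m}. P (i k) (y j)) \<le> (\<Sum>j\<in>{k<..m}. (1 / 2) ^ j)"
        by (intro sum_mono later) auto
      also have "\<dots> \<le> (\<Sum>j. (1 / 2) ^ j)" by (intro sum_le_suminf summable_geometric) auto
      also have "\<dots> = (2::real)" by (subst suminf_geometric) auto
      finally show ?thesis .
    qed
    from s(2)[OF this] have "P (i k) (y k) \<le> P (i k) s + (\<Sum>j<k. P (i k) (y j)) + 2" .
    moreover have "P (i k) s \<le> B s" by (rule B[OF s(1)])
    moreover have "(\<Sum>j<k. P (i k) (y j)) \<le> S k" unfolding S by (intro sum_mono B y)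
    ultimately show ?thesis using y(3)[of k] by linarith
  qed
  moreover obtain k :: nat where "B s + 2 < real k" using reals_Archimedean2 by blast
  ultimately show False by (meson not_le)
qed

text \<open>Completeness of the algebra, in the form of absolutely convergent series: these may be differentiated term by
  term.\<close>

lemma disc_algebra_series:
  assumes M: "weight_sequence M" and x: "\<And>j. x j \<in> disc_algebra M"
    and summable: "summable (\<lambda>j. disc_algebra_norm M (x j))"
  obtains s where "s \<in> disc_algebra M" "disc_algebra_norm M s \<le> (\<Sum>j. disc_algebra_norm M (x j))"
    "\<And>z. z \<in> cball 0 1 \<Longrightarrow> (\<lambda>j. x j z) sums s z"
proof -
  have pos: "M i > 0" for i using M by (simp add: weight_sequence_def)
  have xs: "x j \<in> disc_smooth" for j using x by (rule disc_algebra_smooth)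
  define F where "F n z = (\<Sum>j. (disc_deriv ^^ n) (x j) z)" for n z
  have bound: "norm ((disc_deriv ^^ n) (x j) z) \<le> M n * disc_algebra_norm M (x j)"
    if "z \<in> cball 0 1" for n j z
    by (rule order_trans[OF norm_le_disc_sup_norm[OF xs that] disc_sup_norm_le_algebra_norm[OF M x]])
  have sm: "summable (\<lambda>j. M n * disc_algebra_norm M (x j))" for n by (intro summable_mult summable)
  have snorm: "summable (\<lambda>j. norm ((disc_deriv ^^ n) (x j) z))" if "z \<in> cball 0 1" for n z
  proof (rule summable_comparison_test'[OF sm[of n]])
    show "norm (norm ((disc_deriv ^^ n) (x j) z)) \<le> M n * disc_algebra_norm M (x j)" for j
      unfolding real_norm_def abs_norm_cancel by (rule bound[OF that])
  qed
  have sums: "(\<lambda>j. (disc_deriv ^^ n) (x j) z) sums F n z" if "z \<in> cball 0 1" for n z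
    unfolding F_def by (rule summable_sums[OF summable_norm_cancel[OF snorm[OF that]]])
  have unif: "uniform_limit (cball 0 1) (\<lambda>m z. \<Sum>j<m. (disc_deriv ^^ n) (x j) z) (F n) sequentially" for n
    unfolding F_def[abs_def] by (rule Weierstrass_m_test[OF bound sm])
  have dF: "(F n has_field_derivative F (Suc n) z) (at z within cball 0 1)" if z: "z \<in> cball 0 1" for n z
  proof -
    obtain g where g: "\<And>z. z \<in> cball 0 1 \<Longrightarrow> (\<lambda>j. (disc_deriv ^^ n) (x j) z) sums g z"
      "\<And>z. z \<in> cball 0 1 \<Longrightarrow> (g has_field_derivative F (Suc n) z) (at z within cball 0 1)"
      using has_field_derivative_series[OF convex_cball disc_smooth_has_field_derivative[OF xs] unif z
          sums_summable[OF sums[OF z]], of n] by blast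
    show ?thesis
      by (rule has_field_derivative_transform_within[OF g(2)[OF z], of 1])
        (use z sums_unique2[OF g(1) sums] in auto)
  qed
  have s: "F 0 \<in> disc_smooth" and ds: "\<And>z n. z \<in> cball 0 1 \<Longrightarrow> (disc_deriv ^^ n) (F 0) z = F n z"
    by (rule disc_smooth_sequenceI[where F = F, OF refl dF]; assumption)+
  let ?a = "\<lambda>j n. disc_sup_norm ((disc_deriv ^^ n) (x j))"
  have sa: "summable (\<lambda>j. ?a j n)" for n
  proof (rule summable_comparison_test'[OF sm[of n]])
    show "norm (?a j n) \<le> M n * disc_algebra_norm M (x j)" for j
      unfolding real_norm_def abs_of_nonneg[OF disc_sup_norm_nonneg[OF xs]]
      by (rule disc_sup_norm_le_algebra_norm[OF M x])
  qed
  have "disc_sup_norm ((disc_deriv ^^ n) (F 0)) \<le> (\<Sum>j. ?a j n)" for n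
  proof (rule disc_sup_norm_le)
    fix z :: complex assume z: "z \<in> cball 0 1"
    have "norm (F n z) \<le> (\<Sum>j. norm ((disc_deriv ^^ n) (x j) z))"
      unfolding F_def by (rule summable_norm[OF snorm[OF z]])
    also have "\<dots> \<le> (\<Sum>j. ?a j n)" by (intro suminf_le norm_le_disc_sup_norm xs z snorm sa)
    finally show "norm ((disc_deriv ^^ n) (F 0) z) \<le> (\<Sum>j. ?a j n)" by (simp only: ds[OF z])
  qed
  hence "(\<Sum>n<N. disc_sup_norm ((disc_deriv ^^ n) (F 0)) / M n) \<le> (\<Sum>j. disc_algebra_norm M (x j))" for N
  proof -
    have "(\<Sum>n<N. disc_sup_norm ((disc_deriv ^^ n) (F 0)) / M n) \<le> (\<Sum>n<N. (\<Sum>j. ?a j n) / M n)"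
      using \<open>\<And>n. disc_sup_norm ((disc_deriv ^^ n) (F 0)) \<le> (\<Sum>j. ?a j n)\<close> pos
      by (intro sum_mono divide_right_mono) (auto simp: less_imp_le)
    also have "\<dots> = (\<Sum>j. \<Sum>n<N. ?a j n / M n)"
      by (simp add: suminf_divide[OF sa] suminf_sum[OF summable_divide[OF sa]])
    also have "\<dots> \<le> (\<Sum>j. disc_algebra_norm M (x j))"
      by (intro suminf_le disc_algebra_sum_le_norm M x summable summable_sum summable_divide sa) auto
    finally show ?thesis .
  qed
  note R = disc_algebraI[OF M s this]
  show thesis by (rule that[OF R]) (use sums[of _ 0] in simp)
qed

lemma disc_sup_norm_add_sum_le:
  assumes "finite J" "h \<in> disc_smooth" "\<And>j. j \<in> J \<Longrightarrow> u j \<in> disc_smooth"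
  shows "(\<lambda>z. h z + (\<Sum>j\<in>J. c * u j z)) \<in> disc_smooth \<and>
    disc_sup_norm ((disc_deriv ^^ n) (\<lambda>z. h z + (\<Sum>j\<in>J. c * u j z))) \<le>
    disc_sup_norm ((disc_deriv ^^ n) h) + norm c * (\<Sum>j\<in>J. disc_sup_norm ((disc_deriv ^^ n) (u j)))"
  using assms
proof (induction J rule: finite_induct)
  case (insert j J)
  let ?h = "\<lambda>z. h z + (\<Sum>j\<in>J. c * u j z)"
  have IH: "?h \<in> disc_smooth" "disc_sup_norm ((disc_deriv ^^ n) ?h) \<le>
      disc_sup_norm ((disc_deriv ^^ n) h) + norm c * (\<Sum>j\<in>J. disc_sup_norm ((disc_deriv ^^ n) (u j)))"
    using insert by auto
  have uj: "u j \<in> disc_smooth" using insert by simp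
  have eq: "(\<lambda>z. h z + (\<Sum>j\<in>insert j J. c * u j z)) = (\<lambda>z. ?h z + c * u j z)"
    using insert by (auto simp: algebra_simps)
  have "disc_sup_norm ((disc_deriv ^^ n) (\<lambda>z. ?h z + c * u j z)) \<le>
      disc_sup_norm ((disc_deriv ^^ n) ?h) + norm c * disc_sup_norm ((disc_deriv ^^ n) (u j))"
    using disc_sup_norm_add_le[OF IH(1) disc_smooth_cmult(1)[OF uj], of n c] disc_sup_norm_cmult[OF uj, of n c]
    by simp
  thus ?case unfolding eq using IH(2) insert disc_smooth_add(1)[OF IH(1) disc_smooth_cmult(1)[OF uj]]
    by (simp add: algebra_simps)
qed simp

lemma disc_sup_norm_cong:
  assumes "f \<in> disc_smooth" "\<And>z. z \<in> cball 0 1 \<Longrightarrow> f' z = f z"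
  shows "disc_sup_norm ((disc_deriv ^^ n) f') = disc_sup_norm ((disc_deriv ^^ n) f)"
  unfolding disc_sup_norm_def
proof (rule SUP_cong[OF refl])
  fix z :: complex assume z: "z \<in> cball 0 1"
  have "(disc_deriv ^^ n) f' z = (disc_deriv ^^ n) f z"
    using disc_smooth_sequenceI(2)[where F = "\<lambda>n. (disc_deriv ^^ n) f" and f = f', OF _ _ z]
      disc_smooth_has_field_derivative[OF assms(1)] assms(2) by simp
  thus "norm ((disc_deriv ^^ n) f' z) = norm ((disc_deriv ^^ n) f z)" by simp
qed

lemma disc_sup_norm_compose_le_norm:
  assumes M: "weight_sequence M"
    and \<psi>: "analytic_on_disc \<psi>" "\<psi> ` cball 0 1 \<subseteq> cball 0 1" "\<psi> ` ball 0 1 \<subseteq> ball 0 1"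
  obtains K where "0 \<le> K"
    "\<And>f. f \<in> disc_algebra M \<Longrightarrow> disc_sup_norm ((disc_deriv ^^ n) (f \<circ> \<psi>)) \<le> K * disc_algebra_norm M f"
proof -
  have pos: "M i > 0" for i using M by (simp add: weight_sequence_def)
  obtain A B where AB: "0 < A" "0 < B"
    "\<And>n z. z \<in> cball 0 1 \<Longrightarrow> norm ((disc_deriv ^^ n) \<psi> z) \<le> fact n * (B * A ^ n)"
    using analytic_on_disc_Cauchy_bounds[OF \<psi>(1)] by blast
  define g where "g = Abs_fps (\<lambda>n. B * A ^ n)"
  have gnn: "0 \<le> fps_nth g n" for n using AB by (simp add: g_def)
  have g: "norm ((disc_deriv ^^ n) \<psi> z) / fact n \<le> fps_nth g n" if "z \<in> ball 0 1" for n z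
    using AB(3)[of z n] that by (simp add: g_def field_simps)
  define K where "K = (\<Sum>k\<le>n. fact n / fact k * M k * fps_nth (g ^ k) n)"
  have "disc_sup_norm ((disc_deriv ^^ n) (f \<circ> \<psi>)) \<le> K * disc_algebra_norm M f" if f: "f \<in> disc_algebra M" for f
  proof -
    have "disc_sup_norm ((disc_deriv ^^ n) (f \<circ> \<psi>)) \<le>
        (\<Sum>k\<le>n. fact n / fact k * disc_sup_norm ((disc_deriv ^^ k) f) * fps_nth (g ^ k) n)"
      by (rule disc_sup_norm_compose_le[OF disc_algebra_smooth[OF f] \<psi> gnn g])
    also have "\<dots> \<le> (\<Sum>k\<le>n. fact n / fact k * (M k * disc_algebra_norm M f) * fps_nth (g ^ k) n)"
      by (intro sum_mono mult_right_mono mult_left_mono fps_power_nonneg gnn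
          disc_sup_norm_le_algebra_norm M f) auto
    also have "\<dots> = K * disc_algebra_norm M f" unfolding K_def sum_distrib_right
      by (intro sum.cong refl) (simp only: mult_ac)
    finally show ?thesis .
  qed
  moreover have "0 \<le> K" unfolding K_def
    by (intro sum_nonneg mult_nonneg_nonneg fps_power_nonneg gnn) (auto simp: pos less_imp_le)
  ultimately show thesis by (rule that[rotated])
qed

text \<open>The partial sums \<open>P N f\<close> of the norm of \<open>f \<circ> \<psi>\<close> are continuous seminorms, because each involves finitely
  many derivatives; uniform boundedness of the family is the boundedness of composition with \<open>\<psi>\<close>. To isolate one
  term of a series its tail \<open>r\<close> is split off, whose norm tends to zero.\<close>

lemma induced_endomorphism_bounded:
  assumes M: "weight_sequence M"
    and \<psi>: "analytic_on_disc \<psi>" "\<psi> ` cball 0 1 \<subseteq> cball 0 1" "\<psi> ` ball 0 1 \<subseteq> ball 0 1"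
    and endo: "induces_endomorphism M \<psi>"
  obtains C where "0 < C"
    "\<And>f. f \<in> disc_algebra M \<Longrightarrow> disc_algebra_norm M (f \<circ> \<psi>) \<le> C * disc_algebra_norm M f"
proof -
  have pos: "M i > 0" for i using M by (simp add: weight_sequence_def)
  let ?D = "disc_algebra M" and ?nrm = "disc_algebra_norm M"
  let ?a = "\<lambda>n f. disc_sup_norm ((disc_deriv ^^ n) (f \<circ> \<psi>))"
  define P where "P N f = (\<Sum>n<N. ?a n f / M n)" for N f
  have "\<exists>K\<ge>0. \<forall>f\<in>?D. ?a n f \<le> K * ?nrm f" for n
    using disc_sup_norm_compose_le_norm[OF M \<psi>, of n] by metis
  then obtain k where k: "\<And>n. 0 \<le> k n" "\<And>n f. f \<in> ?D \<Longrightarrow> ?a n f \<le> k n * ?nrm f" by metis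
  define K where "K N = (\<Sum>n<N. k n / M n)" for N
  have K0: "0 \<le> K N" for N unfolding K_def using k pos by (intro sum_nonneg) (simp add: less_imp_le)
  have PK: "P N f \<le> K N * ?nrm f" if f: "f \<in> ?D" for N f
  proof -
    have "P N f \<le> (\<Sum>n<N. k n * ?nrm f / M n)"
      unfolding P_def using pos by (intro sum_mono divide_right_mono k f) (auto simp: less_imp_le)
    thus ?thesis by (simp add: K_def sum_distrib_right)
  qed
  have smo: "f \<circ> \<psi> \<in> disc_smooth" if "f \<in> ?D" for f
    by (rule disc_smooth_compose[OF disc_algebra_smooth[OF that] \<psi>(1,2)])
  have "\<exists>C. \<forall>f\<in>?D. \<forall>N. P N f \<le> C * ?nrm f"
  proof (rule gliding_hump[where K = K])
    fix f and t :: real assume f: "f \<in> ?D" and t: "0 < t"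
    have fs: "f \<in> disc_smooth" by (rule disc_algebra_smooth[OF f])
    let ?g = "\<lambda>z. of_real t * f z"
    have eq: "disc_sup_norm ((disc_deriv ^^ n) ?g) / M n = t * (disc_sup_norm ((disc_deriv ^^ n) f) / M n)" for n
      using disc_sup_norm_cmult[OF fs, of n "of_real t"] t by simp
    have "summable (\<lambda>n. t * (disc_sup_norm ((disc_deriv ^^ n) f) / M n))"
      using f by (intro summable_mult) (simp add: disc_algebra_def)
    hence "?g \<in> ?D" using disc_smooth_cmult(1)[OF fs, of "of_real t"]
      unfolding disc_algebra_def mem_Collect_eq eq by blast
    moreover have "?nrm ?g = t * ?nrm f"
      unfolding disc_algebra_norm_def eq using f by (intro suminf_mult) (simp add: disc_algebra_def)
    moreover have "P N ?g = t * P N f" for N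
    proof -
      have "?g \<circ> \<psi> = (\<lambda>z. of_real t * (f \<circ> \<psi>) z)" by auto
      thus ?thesis unfolding P_def using disc_sup_norm_cmult[OF smo[OF f], of _ "of_real t"] t
        by (simp add: sum_distrib_left)
    qed
    ultimately show "\<exists>y\<in>?D. ?nrm y = t * ?nrm f \<and> (\<forall>N. P N y = t * P N f)" by blast
  next
    fix f assume "f \<in> ?D"
    hence "f \<circ> \<psi> \<in> ?D" using endo by (simp add: induces_endomorphism_def)
    hence "P N f \<le> ?nrm (f \<circ> \<psi>)" for N
      unfolding P_def by (rule disc_algebra_sum_le_norm[OF M]) simp
    thus "\<exists>B. \<forall>N. P N f \<le> B" by blast
  next
    fix x :: "nat \<Rightarrow> complex \<Rightarrow> complex" assume x: "\<And>n. x n \<in> ?D" and sx: "summable (\<lambda>n. ?nrm (x n))"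
    obtain s where s: "s \<in> ?D" "\<And>z. z \<in> cball 0 1 \<Longrightarrow> (\<lambda>j. x j z) sums s z"
      using disc_algebra_series[OF M x sx] by blast
    have "P N (x k) \<le> P N s + (\<Sum>j<k. P N (x j)) + T"
      if T: "\<And>m. (\<Sum>j\<in>{k<..m}. P N (x j)) \<le> T" for N k T
    proof -
      have le: "P N (x k) \<le> P N s + (\<Sum>j<k. P N (x j)) + T + K N * (\<Sum>j. ?nrm (x (j + Suc m)))" if m: "k \<le> m" for m
      proof -
        have "summable (\<lambda>j. ?nrm (x (j + Suc m)))" by (rule summable_ignore_initial_segment[OF sx])
        from disc_algebra_series[of M "\<lambda>j. x (j + Suc m)", OF M x this]
        obtain r where r: "r \<in> ?D" "?nrm r \<le> (\<Sum>j. ?nrm (x (j + Suc m)))"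
          "\<And>z. z \<in> cball 0 1 \<Longrightarrow> (\<lambda>j. x (j + Suc m) z) sums r z"
          by metis
        let ?J = "{..m} - {k}"
        have split: "x k z = s z + (\<Sum>j\<in>?J. (- 1) * x j z) + (- 1) * r z" if "z \<in> cball 0 1" for z
        proof -
          have "(\<lambda>j. x (j + Suc m) z) sums (s z - (\<Sum>j<Suc m. x j z))"
            by (rule sums_split_initial_segment[OF s(2)[OF that]])
          hence "r z = s z - (\<Sum>j<Suc m. x j z)" using r(3)[OF that] sums_unique2 by blast
          also have "(\<Sum>j<Suc m. x j z) = x k z + (\<Sum>j\<in>?J. x j z)"
            using m by (simp only: lessThan_Suc_atMost) (simp add: sum.remove)
          finally show ?thesis by (simp add: sum_negf)
        qed
        let ?h = "\<lambda>z. (s \<circ> \<psi>) z + (\<Sum>j\<in>?J. (- 1) * (x j \<circ> \<psi>) z)"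
        have est: "?a n (x k) \<le> ?a n s + (\<Sum>j\<in>?J. ?a n (x j)) + ?a n r" for n
        proof -
          have h: "?h \<in> disc_smooth" "disc_sup_norm ((disc_deriv ^^ n) ?h) \<le> ?a n s + (\<Sum>j\<in>?J. ?a n (x j))"
            using disc_sup_norm_add_sum_le[of ?J "s \<circ> \<psi>" "\<lambda>j. x j \<circ> \<psi>" "- 1" n] smo s(1) x by auto
          have rs: "(\<lambda>z. (- 1) * (r \<circ> \<psi>) z) \<in> disc_smooth"
            by (rule disc_smooth_cmult(1)[OF smo[OF r(1)]])
          have "?a n (x k) = disc_sup_norm ((disc_deriv ^^ n) (\<lambda>z. ?h z + (- 1) * (r \<circ> \<psi>) z))"
          proof (rule disc_sup_norm_cong[OF disc_smooth_add(1)[OF h(1) rs]])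
            fix z :: complex assume "z \<in> cball 0 1"
            hence "\<psi> z \<in> cball 0 1" using \<psi>(2) by blast
            from split[OF this] show "(x k \<circ> \<psi>) z = ?h z + (- 1) * (r \<circ> \<psi>) z" by simp
          qed
          also have "\<dots> \<le> disc_sup_norm ((disc_deriv ^^ n) ?h) + disc_sup_norm ((disc_deriv ^^ n) (\<lambda>z. (- 1) * (r \<circ> \<psi>) z))"
            by (rule disc_sup_norm_add_le[OF h(1) rs])
          also have "disc_sup_norm ((disc_deriv ^^ n) (\<lambda>z. (- 1) * (r \<circ> \<psi>) z)) = ?a n r"
            using disc_sup_norm_cmult[OF smo[OF r(1)], of n "- 1"] by simp
          finally show ?thesis using h(2) by linarith
        qed
        have "P N (x k) \<le> (\<Sum>n<N. (?a n s + (\<Sum>j\<in>?J. ?a n (x j)) + ?a n r) / M n)"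
          unfolding P_def using pos by (intro sum_mono divide_right_mono est) (auto simp: less_imp_le)
        also have "\<dots> = P N s + (\<Sum>j\<in>?J. P N (x j)) + P N r"
          unfolding P_def by (simp add: add_divide_distrib sum.distrib sum_divide_distrib sum.swap[of _ ?J])
        also have "(\<Sum>j\<in>?J. P N (x j)) = (\<Sum>j<k. P N (x j)) + (\<Sum>j\<in>{k<..m}. P N (x j))"
        proof -
          have "?J = {..<k} \<union> {k<..m}" using m by auto
          thus ?thesis by (simp add: sum.union_disjoint disjoint_iff)
        qed
        also note T[of m]
        also have "P N r \<le> K N * (\<Sum>j. ?nrm (x (j + Suc m)))"
          by (rule order_trans[OF PK[OF r(1)] mult_left_mono[OF r(2) K0]])
        finally show ?thesis by simp
      qed
      have "(\<lambda>m. \<Sum>j. ?nrm (x (j + Suc m))) \<longlonglongrightarrow> 0"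
        using suminf_exist_split2[OF sx] by (rule LIMSEQ_Suc)
      hence "(\<lambda>m. P N s + (\<Sum>j<k. P N (x j)) + T + K N * (\<Sum>j. ?nrm (x (j + Suc m))))
          \<longlonglongrightarrow> P N s + (\<Sum>j<k. P N (x j)) + T + K N * 0"
        by (intro tendsto_intros)
      moreover have "\<forall>\<^sub>F m in sequentially. P N (x k) \<le> P N s + (\<Sum>j<k. P N (x j)) + T + K N * (\<Sum>j. ?nrm (x (j + Suc m)))"
        using le by (auto simp: eventually_sequentially)
      ultimately have "P N (x k) \<le> P N s + (\<Sum>j<k. P N (x j)) + T + K N * 0"
        by (intro tendsto_lowerbound) auto
      thus ?thesis by simp
    qed
    thus "\<exists>s\<in>?D. \<forall>N k T. (\<forall>m. (\<Sum>j\<in>{k<..m}. P N (x j)) \<le> T) \<longrightarrow> P N (x k) \<le> P N s + (\<Sum>j<k. P N (x j)) + T"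
      using s(1) by blast
  qed (use disc_algebra_norm_nonneg[OF M] K0 PK in auto)
  then obtain C where C: "\<And>f N. f \<in> ?D \<Longrightarrow> P N f \<le> C * ?nrm f" by blast
  have "?nrm (f \<circ> \<psi>) \<le> max C 1 * ?nrm f" if f: "f \<in> ?D" for f
  proof (rule disc_algebraI(2)[OF M smo[OF f]])
    fix N
    have "P N f \<le> max C 1 * ?nrm f"
      by (rule order_trans[OF C[OF f] mult_right_mono]) (use disc_algebra_norm_nonneg[OF M f] in auto)
    thus "(\<Sum>n<N. ?a n f / M n) \<le> max C 1 * ?nrm f" by (simp add: P_def)
  qed
  moreover have "0 < max C 1" by (rule less_le_trans[OF zero_less_one max.cobounded2])
  ultimately show thesis by (rule that[rotated])
qed

section \<open>Repelling fixed points obstruct endomorphisms\<close>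

lemma analytic_on_disc_compose:
  assumes f: "analytic_on_disc f" and g: "analytic_on_disc g" "g ` cball 0 1 \<subseteq> cball 0 1"
  shows "analytic_on_disc (f \<circ> g)"
proof -
  obtain U F where F: "open U" "cball 0 1 \<subseteq> U" "F holomorphic_on U" "\<And>z. z \<in> cball 0 1 \<Longrightarrow> F z = f z"
    using f unfolding analytic_on_disc_def by blast
  obtain V G where G: "open V" "cball 0 1 \<subseteq> V" "G holomorphic_on V" "\<And>z. z \<in> cball 0 1 \<Longrightarrow> G z = g z"
    using g unfolding analytic_on_disc_def by blast
  define W where "W = {z \<in> V. G z \<in> U}"
  have "open (V \<inter> G -` U)"
    by (rule continuous_open_preimage[OF holomorphic_on_imp_continuous_on[OF G(3)] G(1) F(1)])
  hence "open W" by (simp add: W_def vimage_def Int_def)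
  moreover have "cball 0 1 \<subseteq> W"
  proof
    fix z :: complex assume z: "z \<in> cball 0 1"
    hence "g z \<in> U" using g(2) F(2) by blast
    thus "z \<in> W" using G(2,4) z by (auto simp: W_def)
  qed
  moreover have "F \<circ> G holomorphic_on W"
    by (rule holomorphic_on_compose_gen[OF holomorphic_on_subset[OF G(3)] F(3)]) (auto simp: W_def)
  moreover have "(F \<circ> G) z = (f \<circ> g) z" if "z \<in> cball 0 1" for z
  proof -
    have "g z \<in> cball 0 1" using g(2) that by blast
    thus ?thesis using F(4) G(4)[OF that] by simp
  qed
  ultimately show ?thesis unfolding analytic_on_disc_def by blast
qed

lemma analytic_on_disc_id: "analytic_on_disc id"
  unfolding analytic_on_disc_def by (intro exI[of _ UNIV] exI[of _ id]) auto

lemma analytic_on_disc_funpow: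
  assumes "analytic_on_disc \<phi>" "\<phi> ` cball 0 1 \<subseteq> cball 0 1"
  shows "analytic_on_disc (\<phi> ^^ n)" and "(\<phi> ^^ n) ` cball 0 1 \<subseteq> cball 0 1"
proof -
  show im: "(\<phi> ^^ n) ` cball 0 1 \<subseteq> cball 0 1" for n
    using funpow_ball[OF assms(2)] by blast
  show "analytic_on_disc (\<phi> ^^ n)"
  proof (induction n)
    case (Suc n)
    show ?case unfolding funpow.simps by (rule analytic_on_disc_compose[OF assms(1) Suc im])
  qed (simp only: funpow.simps analytic_on_disc_id)
qed

lemma disc_deriv_funpow_fixpoint:
  assumes "(\<psi> has_field_derivative d) (at w within cball 0 1)" "\<psi> ` cball 0 1 \<subseteq> cball 0 1"
    and w: "w \<in> cball 0 1" "\<psi> w = w"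
  shows "(\<psi> ^^ k has_field_derivative d ^ k) (at w within cball 0 1)"
proof (induction k)
  case (Suc k)
  have fw: "(\<psi> ^^ k) w = w" by (induction k) (auto simp: w)
  have "(\<psi> has_field_derivative d) (at ((\<psi> ^^ k) w) within (\<psi> ^^ k) ` cball 0 1)"
    unfolding fw using assms(1) by (rule DERIV_subset) (use funpow_ball[OF assms(2)] in blast)
  from DERIV_image_chain[OF this Suc] show ?case by (simp only: funpow.simps power_Suc)
qed (simp add: id_def)

text \<open>The Taylor expansion of \<open>\<eta>\<close> at \<open>w\<close> is \<open>w + d t + \<dots>\<close>, so its difference from \<open>w\<close>, raised to the power \<open>n\<close>, starts with
  \<open>d\<^sup>n t\<^sup>n\<close>.\<close>

lemma disc_deriv_power_at_fixpoint:
  assumes \<eta>: "analytic_on_disc \<eta>" and w: "w \<in> cball 0 1" "\<eta> w = w"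
    and d: "(\<eta> has_field_derivative d) (at w within cball 0 1)"
  shows "(disc_deriv ^^ n) ((\<lambda>z. (z - w) ^ n) \<circ> \<eta>) w = fact n * d ^ n"
proof -
  obtain U g where U: "open U" "cball 0 1 \<subseteq> U" "g holomorphic_on U" "\<And>z. z \<in> cball 0 1 \<Longrightarrow> g z = \<eta> z"
    using \<eta> unfolding analytic_on_disc_def by blast
  have wU: "w \<in> U" using w U by blast
  define h where "h z = (g z - w) ^ n" for z
  have h: "h holomorphic_on U" unfolding h_def by (intro holomorphic_intros U)
  have "(disc_deriv ^^ n) ((\<lambda>z. (z - w) ^ n) \<circ> \<eta>) w = (deriv ^^ n) h w"
    by (rule holomorphic_imp_disc_smooth(2)[OF U(1,2) h _ w(1)]) (simp add: h_def U(4))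
  also have "\<dots> = (deriv ^^ n) (h \<circ> (\<lambda>t. w + t)) 0" by (rule higher_deriv_shift_0)
  finally have 1: "(disc_deriv ^^ n) ((\<lambda>z. (z - w) ^ n) \<circ> \<eta>) w = (deriv ^^ n) (h \<circ> (\<lambda>t. w + t)) 0" .
  define p where "p = (\<lambda>t. g (w + t) - w)"
  define V where "V = (\<lambda>t. w + t) -` U"
  have V: "open V" "0 \<in> V"
    using wU U(1) by (auto simp: V_def intro!: open_vimage continuous_intros)
  have "g \<circ> (\<lambda>t. w + t) holomorphic_on V"
    by (rule holomorphic_on_compose_gen[OF _ U(3)]) (auto simp: V_def intro!: holomorphic_intros)
  hence "p holomorphic_on V" unfolding p_def o_def by (intro holomorphic_intros)
  hence p: "p has_fps_expansion fps_expansion p 0" by (rule has_fps_expansion_fps_expansion[OF V])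
  define G where "G = fps_expansion p 0"
  have G0: "fps_nth G 0 = 0" using fps_nth_fps_expansion[OF p, of 0] U(4)[OF w(1)] w(2)
    by (simp add: G_def p_def)
  have gd: "(g has_field_derivative d) (at w)"
  proof -
    have D: "(g has_field_derivative deriv g w) (at w)" by (rule holomorphic_derivI[OF U(3,1) wU])
    have "(\<eta> has_field_derivative deriv g w) (at w within cball 0 1)"
      by (rule has_field_derivative_transform_within[OF has_field_derivative_at_within[OF D], of 1])
        (use U w in auto)
    hence "deriv g w = d" using disc_deriv_eqI[OF _ w(1)] d by metis
    thus ?thesis using D by simp
  qed
  have "(p has_field_derivative d) (at 0)"
    unfolding p_def using DERIV_shift[of g d 0 w] gd
      by (auto intro!: derivative_eq_intros simp: add.commute)
  hence G1: "fps_nth G 1 = d"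
    using fps_nth_fps_expansion[OF p, of 1] by (simp add: G_def DERIV_imp_deriv)
  have "(\<lambda>t. p t ^ n) has_fps_expansion G ^ n" unfolding G_def by (intro has_fps_expansion_power p)
  from fps_nth_fps_expansion[OF this, of n]
  have "(deriv ^^ n) (\<lambda>t. p t ^ n) 0 = fact n * d ^ n"
    using startsby_zero_power_nth_same[OF G0, of n] G1 by simp
  moreover have "h \<circ> (\<lambda>t. w + t) = (\<lambda>t. p t ^ n)" by (auto simp: h_def p_def)
  ultimately show ?thesis using 1 by simp
qed

text \<open>On functions vanishing to order \<open>n\<close> at \<open>w\<close>, composition with \<open>\<psi>\<close> multiplies \<open>f\<^sup>(\<^sup>n\<^sup>)(w)\<close> by \<open>d\<^sup>n\<close>. If composition
  were bounded by \<open>C\<close>, then iterating it on \<open>(z - w)\<^sup>n\<close> would force \<open>|d|\<^sup>n \<le> C\<close>, for every \<open>n\<close>.\<close>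

lemma repelling_fixpoint_no_endomorphism:
  assumes M: "weight_sequence M" "nonanalytic M"
    and \<psi>: "analytic_on_disc \<psi>" "\<psi> ` cball 0 1 \<subseteq> cball 0 1" "\<psi> ` ball 0 1 \<subseteq> ball 0 1"
    and w: "w \<in> cball 0 1" "\<psi> w = w"
    and d: "(\<psi> has_field_derivative d) (at w within cball 0 1)" "1 < norm d"
  shows "\<not> induces_endomorphism M \<psi>"
proof
  assume endo: "induces_endomorphism M \<psi>"
  have pos: "M i > 0" for i using M by (simp add: weight_sequence_def)
  obtain C where C: "0 < C"
    "\<And>f. f \<in> disc_algebra M \<Longrightarrow> disc_algebra_norm M (f \<circ> \<psi>) \<le> C * disc_algebra_norm M f"
    using induced_endomorphism_bounded[OF M(1) \<psi> endo] by blast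
  \<comment> \<open>With \<open>n\<close> fixed, letting the number \<open>k\<close> of compositions grow gives the contradiction.\<close>
  obtain n where n: "C < norm d ^ n" using real_arch_pow[OF d(2)] by blast
  define f where "f = (\<lambda>z. (z - w) ^ n)"
  have "analytic_on_disc f"
    unfolding analytic_on_disc_def f_def
    by (intro exI[of _ UNIV] exI[of _ "\<lambda>z. (z - w) ^ n"]) (auto intro!: holomorphic_intros)
  hence f: "f \<in> disc_algebra M" by (rule analytic_on_disc_imp_disc_algebra[OF M])
  have fk: "f \<circ> \<psi> ^^ k \<in> disc_algebra M \<and> disc_algebra_norm M (f \<circ> \<psi> ^^ k) \<le> C ^ k * disc_algebra_norm M f" for k
  proof (induction k)
    case (Suc k)
    hence IH: "f \<circ> \<psi> ^^ k \<in> disc_algebra M" "disc_algebra_norm M (f \<circ> \<psi> ^^ k) \<le> C ^ k * disc_algebra_norm M f"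
      by blast+
    have eq: "f \<circ> \<psi> ^^ Suc k = (f \<circ> \<psi> ^^ k) \<circ> \<psi>"
      by (simp add: funpow_Suc_right o_assoc del: funpow.simps)
    have "disc_algebra_norm M (f \<circ> \<psi> ^^ Suc k) \<le> C * (C ^ k * disc_algebra_norm M f)"
      unfolding eq by (rule order_trans[OF C(2)[OF IH(1)] mult_left_mono[OF IH(2)]]) (use C(1) in simp)
    moreover have "f \<circ> \<psi> ^^ Suc k \<in> disc_algebra M"
      unfolding eq using IH(1) endo unfolding induces_endomorphism_def by blast
    ultimately show ?case unfolding power_Suc mult.assoc by blast
  qed (simp add: f)
  define A where "A = M n * disc_algebra_norm M f / fact n"
  have "(norm d ^ n / C) ^ k \<le> A" for k
  proof -
    note an = analytic_on_disc_funpow(1)[OF \<psi>(1,2), of k]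
    have fw: "(\<psi> ^^ k) w = w" by (induction k) (auto simp: w)
    have "(disc_deriv ^^ n) (f \<circ> \<psi> ^^ k) w = fact n * (d ^ k) ^ n"
      unfolding f_def
      by (rule disc_deriv_power_at_fixpoint[OF an w(1) fw disc_deriv_funpow_fixpoint[OF d(1) \<psi>(2) w]])
    moreover have "norm ((disc_deriv ^^ n) (f \<circ> \<psi> ^^ k) w) \<le> M n * disc_algebra_norm M (f \<circ> \<psi> ^^ k)"
      by (rule order_trans[OF norm_le_disc_sup_norm[OF disc_algebra_smooth w(1)]
            disc_sup_norm_le_algebra_norm[OF M(1)]]) (use fk in blast)+
    ultimately have "fact n * (norm d ^ n) ^ k \<le> M n * disc_algebra_norm M (f \<circ> \<psi> ^^ k)"
      by (simp add: norm_mult norm_power power_mult[symmetric] mult.commute)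
    also have "\<dots> \<le> M n * (C ^ k * disc_algebra_norm M f)"
      using fk pos by (intro mult_left_mono) (auto simp: less_imp_le)
    finally show ?thesis using C(1) by (simp add: A_def power_divide divide_simps mult_ac)
  qed
  moreover have "1 < norm d ^ n / C" using n C(1) by simp
  then obtain k where "A < (norm d ^ n / C) ^ k" using real_arch_pow by blast
  ultimately show False by (meson not_le)
qed

lemma induces_endomorphism_funpow:
  assumes "induces_endomorphism M \<psi>"
  shows "induces_endomorphism M (\<psi> ^^ n)"
  unfolding induces_endomorphism_def
proof
  fix f assume f: "f \<in> disc_algebra M"
  show "f \<circ> \<psi> ^^ n \<in> disc_algebra M"
  proof (induction n)
    case (Suc n)
    have "f \<circ> \<psi> ^^ Suc n = (f \<circ> \<psi> ^^ n) \<circ> \<psi>" by (simp add: funpow_Suc_right o_assoc del: funpow.simps)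
    moreover have "(f \<circ> \<psi> ^^ n) \<circ> \<psi> \<in> disc_algebra M"
      using Suc assms unfolding induces_endomorphism_def by blast
    ultimately show ?case by (simp only:)
  qed (simp add: f)
qed

lemma analytic_self_map_cases:
  assumes \<phi>: "analytic_on_disc \<phi>" "\<phi> ` cball 0 1 \<subseteq> cball 0 1"
  obtains "\<phi> ` ball 0 1 \<subseteq> ball 0 1" | c where "norm c = 1" "\<And>z. z \<in> cball 0 1 \<Longrightarrow> \<phi> z = c"
proof -
  note s = analytic_on_disc_smooth[OF \<phi>(1)]
  have hol: "\<phi> holomorphic_on ball 0 1" using disc_smooth_holomorphic[OF s, of 0] by simp
  have cont: "continuous_on (cball 0 1) \<phi>" using disc_smooth_continuous[OF s, of 0] by simp
  have im: "\<phi> ` ball 0 1 \<subseteq> cball 0 1" using \<phi>(2) ball_subset_cball by blast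
  show thesis
  proof (rule self_map_interior_cases[OF hol im])
    fix c assume c: "norm c = 1" "\<And>z. z \<in> ball 0 1 \<Longrightarrow> \<phi> z = c"
    have "\<phi> z = c" if "z \<in> cball 0 1" for z
      using continuous_constant_on_closure[of "ball 0 1" \<phi> c z] cont c(2) that by simp
    thus thesis using c(1) that(2) by blast
  qed (rule that(1))
qed

lemma multiple_boundary_fixpoints_no_endomorphism:
  assumes M: "weight_sequence M" "nonanalytic M"
    and \<phi>: "analytic_on_disc \<phi>" "\<phi> ` cball 0 1 \<subseteq> cball 0 1"
    and nofix: "\<And>z. z \<in> ball 0 1 \<Longrightarrow> \<phi> z \<noteq> z"
    and N: "0 < N" "multiple_boundary_fixpoints (\<phi> ^^ N)"
  shows "\<not> induces_endomorphism M \<phi>"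
proof
  assume endo: "induces_endomorphism M \<phi>"
  obtain a b where ab: "norm a = 1" "(\<phi> ^^ N) a = a" "norm b = 1" "(\<phi> ^^ N) b = b" "a \<noteq> b"
    using N(2) by (auto simp: multiple_boundary_fixpoints_def boundary_fixpoints_def)
  show False
  proof (rule analytic_self_map_cases[OF \<phi>])
    fix c assume c: "\<And>z. z \<in> cball 0 1 \<Longrightarrow> \<phi> z = c"
    have "(\<phi> ^^ N) z = c" if z: "z \<in> cball 0 1" for z
    proof -
      obtain m where m: "N = Suc m" using N(1) by (cases N) auto
      have "(\<phi> ^^ m) z \<in> cball 0 1" by (rule funpow_ball[OF \<phi>(2) z])
      thus ?thesis using c by (simp add: m)
    qed
    thus False using ab by simp
  next
    assume inner: "\<phi> ` ball 0 1 \<subseteq> ball 0 1"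
    note s = analytic_on_disc_smooth[OF \<phi>(1)]
    have hol: "\<phi> holomorphic_on ball 0 1" using disc_smooth_holomorphic[OF s, of 0] by simp
    have cont: "continuous_on (cball 0 1) \<phi>" using disc_smooth_continuous[OF s, of 0] by simp
    obtain p where p: "norm p = 1"
      "\<And>z. z \<in> ball 0 1 \<Longrightarrow> (1 - (norm z)\<^sup>2) * (norm (p - \<phi> z))\<^sup>2 \<le> (1 - (norm (\<phi> z))\<^sup>2) * (norm (p - z))\<^sup>2"
      using Wolff_point[OF hol cont \<phi>(2) nofix] by blast
    obtain w where w: "norm w = 1" "w \<noteq> p" "(\<phi> ^^ N) w = w" using ab by metis
    have wc: "w \<in> cball 0 1" using w by simp
    note an = analytic_on_disc_funpow[OF \<phi>, of N]
    have d: "(\<phi> ^^ N has_field_derivative disc_deriv (\<phi> ^^ N) w) (at w within cball 0 1)"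
      using disc_smooth_has_field_derivative[OF analytic_on_disc_smooth[OF an(1)] wc, of 0] by simp
    have "1 < norm (disc_deriv (\<phi> ^^ N) w)"
      by (rule iterate_repelling_boundary_fixpoint[OF hol inner nofix p N(1) w d])
    moreover have "(\<phi> ^^ N) ` ball 0 1 \<subseteq> ball 0 1" using funpow_ball[OF inner] by blast
    ultimately have "\<not> induces_endomorphism M (\<phi> ^^ N)"
      by (intro repelling_fixpoint_no_endomorphism[OF M an _ wc w(3) d])
    thus False using induces_endomorphism_funpow[OF endo] by blast
  qed
qed

section \<open>Contact of the image with the unit circle\<close>

lemma cis_eq_1_imp:
  assumes "cis x = 1"
  obtains n :: int where "x = 2 * pi * of_int n"
proof -
  have "exp (\<i> * of_real x) = 1" using assms by (simp add: cis_conv_exp)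
  then obtain n :: int where "Im (\<i> * of_real x) = of_int (2 * n) * pi" unfolding exp_eq_1 by blast
  thus thesis using that[of n] by (simp add: mult_ac)
qed

lemma has_vector_derivative_cis_compose:
  assumes "(u has_real_derivative u') (at t)"
  shows "((\<lambda>t. cis (u t)) has_vector_derivative \<i> * of_real u' * cis (u t)) (at t)"
proof -
  have "((\<lambda>t. \<i> * of_real (u t)) has_vector_derivative \<i> * of_real u') (at t)"
    using assms by (intro has_vector_derivative_mult_right has_vector_derivative_of_real)
  from field_vector_diff_chain_at[OF this DERIV_exp] show ?thesis
    by (simp add: o_def cis_conv_exp)
qed

lemma cis_Arg_unimodular: "norm z = 1 \<Longrightarrow> cis (Arg z) = z"
  by (cases "z = 0") (simp_all add: cis_Arg sgn_div_norm)

text \<open>A real analytic function on the circle vanishes at finitely many points or everywhere; here it is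
  \<open>|\<phi>|\<^sup>2 - 1\<close>, continued to a strip in the angular variable.\<close>

lemma unimodular_finite_or_all:
  assumes \<phi>: "analytic_on_disc \<phi>"
  obtains "finite {z. norm z = 1 \<and> norm (\<phi> z) = 1}" | "\<And>z. norm z = 1 \<Longrightarrow> norm (\<phi> z) = 1"
proof (cases "finite {z. norm z = 1 \<and> norm (\<phi> z) = 1}")
  case False
  define E where "E = {z. norm z = 1 \<and> norm (\<phi> z) = 1}"
  obtain \<delta> g where g: "0 < \<delta>" "g holomorphic_on ball 0 (1 + \<delta>)" "\<And>z. z \<in> cball 0 1 \<Longrightarrow> g z = \<phi> z"
    using analytic_on_disc_extension[OF \<phi>] by blast
  define l where "l = ln (1 + \<delta>)"
  have l: "0 < l" using g(1) by (simp add: l_def)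
  define S where "S = {t. - l < Im t} \<inter> {t. Im t < l}"
  have S: "open S" "connected S"
    unfolding S_def
    by (auto intro!: open_Int convex_connected convex_Int open_halfspace_Im_gt open_halfspace_Im_lt
        convex_halfspace_Im_gt convex_halfspace_Im_lt)
  \<comment> \<open>On the real axis \<open>cnj \<circ> q \<circ> cnj\<close> is the conjugate of \<open>q\<close>, so the holomorphic function \<open>h\<close> below extends
    \<open>|\<phi>|\<^sup>2 - 1\<close>.\<close>
  define q where "q t = g (exp (\<i> * t))" for t
  have q: "q holomorphic_on S"
  proof -
    have "(\<lambda>t. exp (\<i> * t)) ` S \<subseteq> ball 0 (1 + \<delta>)"
    proof
      fix w assume "w \<in> (\<lambda>t. exp (\<i> * t)) ` S"
      then obtain t where t: "t \<in> S" "w = exp (\<i> * t)" by blast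
      have "norm w = exp (- Im t)" by (simp add: t(2))
      also have "\<dots> < exp l" using t(1) by (simp add: S_def)
      finally show "w \<in> ball 0 (1 + \<delta>)" using g(1) by (simp add: l_def)
    qed
    from holomorphic_on_compose_gen[OF _ g(2) this] show ?thesis
      unfolding q_def o_def by (auto intro!: holomorphic_intros)
  qed
  define h where "h t = q t * (cnj \<circ> q \<circ> cnj) t - 1" for t
  have "cnj ` S = S"
  proof
    show "S \<subseteq> cnj ` S"
    proof
      fix t assume "t \<in> S"
      hence "cnj t \<in> S" "t = cnj (cnj t)" by (auto simp: S_def)
      thus "t \<in> cnj ` S" by blast
    qed
  qed (auto simp: S_def)
  hence "cnj \<circ> q \<circ> cnj holomorphic_on S" using q S(1) by (intro holomorphic_on_compose_cnj_cnj) auto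
  hence h: "h holomorphic_on S" unfolding h_def by (intro holomorphic_intros q)
  have hreal: "h (of_real t) = of_real ((norm (\<phi> (cis t)))\<^sup>2 - 1)" for t :: real
    using g(3)[of "cis t"] complex_norm_square[of "\<phi> (cis t)"] by (simp add: h_def q_def cis_conv_exp)
  define U where "U = complex_of_real ` Arg ` E"
  note cisArg = cis_Arg_unimodular
  have "inj_on (\<lambda>z. complex_of_real (Arg z)) E"
    by (rule inj_on_inverseI[where g = "\<lambda>w. cis (Re w)"]) (simp add: E_def cisArg)
  hence "infinite U" using False unfolding U_def image_image E_def[symmetric]
    by (simp add: finite_image_iff)
  moreover have "U \<subseteq> complex_of_real ` {- pi..pi}"
  proof -
    have "Arg z \<in> {- pi..pi}" for z using Arg_bounded[of z] by simp
    thus ?thesis unfolding U_def by blast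
  qed
  moreover have "compact (complex_of_real ` {- pi..pi})"
    by (intro compact_continuous_image continuous_intros) auto
  ultimately obtain \<xi> where \<xi>: "\<xi> \<in> complex_of_real ` {- pi..pi}" "\<xi> islimpt U"
    unfolding compact_eq_Bolzano_Weierstrass by blast
  have "U \<subseteq> S" "\<xi> \<in> S" using \<xi>(1) l by (auto simp: U_def S_def)
  moreover have "h t = 0" if "t \<in> U" for t
    using that unfolding U_def E_def by (auto simp: hreal cisArg)
  ultimately have h0: "h t = 0" if "t \<in> S" for t
    using analytic_continuation[OF h S _ _ \<xi>(2) _ that] by blast
  have "norm (\<phi> z) = 1" if z: "norm z = 1" for z
  proof -
    have "complex_of_real (Arg z) \<in> S" using l by (simp add: S_def)
    from h0[OF this] have "(norm (\<phi> z))\<^sup>2 = 1\<^sup>2"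
      unfolding hreal cisArg[OF z] of_real_eq_0_iff by simp
    thus ?thesis by (rule power2_eq_imp_eq) simp_all
  qed
  thus thesis by (rule that(2))
qed (use that(1) in blast)

text \<open>An inner function with an attracting boundary fixed point has a second fixed point on the circle. On the
  circle the map is \<open>cis \<theta> \<mapsto> cis (\<eta> \<theta>)\<close> with \<open>\<eta>\<close> nondecreasing. Over one period, starting at the given fixed
  point, \<open>\<eta> \<theta> - \<theta>\<close> starts at \<open>0\<close>, ends at a value \<open>\<ge> 0\<close> (the degree of the map is at least \<open>1\<close>) and is decreasing
  near both ends, so it has a zero in between.\<close>

lemma inner_attracting_second_fixpoint:
  assumes \<phi>: "analytic_on_disc \<phi>" "\<phi> ` cball 0 1 \<subseteq> cball 0 1" "\<phi> ` ball 0 1 \<subseteq> ball 0 1"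
    and uni: "\<And>z. norm z = 1 \<Longrightarrow> norm (\<phi> z) = 1"
    and z1: "norm z1 = 1" "\<phi> z1 = z1" "Re (disc_deriv \<phi> z1) < 1"
  obtains z2 where "norm z2 = 1" "\<phi> z2 = z2" "z2 \<noteq> z1"
proof -
  obtain \<delta> g where g: "0 < \<delta>" "g holomorphic_on ball 0 (1 + \<delta>)" "\<And>z. z \<in> cball 0 1 \<Longrightarrow> g z = \<phi> z"
    using analytic_on_disc_extension[OF \<phi>(1)] by blast
  have cb: "cis t \<in> cball 0 1" "cis t \<in> ball 0 (1 + \<delta>)" for t using g(1) by auto
  have gd: "(g has_field_derivative deriv g (cis t)) (at (cis t))" for t
    by (rule holomorphic_derivI[OF g(2) open_ball cb(2)])
  have \<phi>d: "(\<phi> has_field_derivative deriv g (cis t)) (at (cis t) within cball 0 1)" for t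
    by (rule has_field_derivative_transform_within[OF has_field_derivative_at_within[OF gd], of 1])
      (use g(3) cb in auto)
  have g1: "g (cis t) * cnj (g (cis t)) = 1" for t
    by (rule unimodular_mult_cnj) (simp add: g(3)[OF cb(1)] uni)
  define k where "k t = Re (deriv g (cis t) * cis t * cnj (g (cis t)))" for t
  \<comment> \<open>\<open>k\<close> is the angular derivative of the circle map, and \<open>\<eta>\<close> its antiderivative.\<close>
  have k0: "0 \<le> k t" and kc: "deriv g (cis t) * cis t * cnj (g (cis t)) = of_real (k t)" for t
    using boundary_derivative_real_nonneg[OF \<phi>(2) \<phi>d[of t]] uni[of "cis t"] g(3)[OF cb(1)[of t]]
    by (auto simp: k_def complex_eq_iff)
  have kg: "deriv g (cis t) * cis t = of_real (k t) * g (cis t)" for t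
  proof -
    have "deriv g (cis t) * cis t = deriv g (cis t) * cis t * cnj (g (cis t)) * g (cis t)"
      using g1[of t] by (simp add: mult.assoc mult.commute[of "cnj _"])
    thus ?thesis by (simp only: kc)
  qed
  have "continuous_on UNIV (\<lambda>t. deriv g (cis t) * cis t * cnj (g (cis t)))"
  proof -
    have "continuous_on (ball 0 (1 + \<delta>)) (deriv g)" "continuous_on (ball 0 (1 + \<delta>)) g"
      using g(2) holomorphic_deriv[OF g(2) open_ball] holomorphic_on_imp_continuous_on by blast+
    hence "continuous_on UNIV (\<lambda>t. deriv g (cis t))" "continuous_on UNIV (\<lambda>t. g (cis t))"
      using cb(2) by (auto intro!: continuous_on_compose2[of _ _ _ cis] continuous_intros)
    thus ?thesis by (intro continuous_intros)
  qed
  hence "continuous_on UNIV k" unfolding k_def[abs_def] by (rule continuous_on_Re)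
  hence kcont: "continuous_on A k" for A by (rule continuous_on_subset) simp
  define a where "a = Arg z1"
  have a: "cis a = z1" unfolding a_def by (rule cis_Arg_unimodular[OF z1(1)])
  define I where "I = {a - 1<..<a + 2 * pi + 1}"
  obtain A where A: "\<And>t. t \<in> {a - 1..a + 2 * pi + 1} \<Longrightarrow> (A has_vector_derivative k t) (at t within {a - 1..a + 2 * pi + 1})"
    using antiderivative_continuous[OF kcont] by blast
  define \<eta> where "\<eta> t = a + (A t - A a)" for t
  have d\<eta>: "(\<eta> has_real_derivative k t) (at t)" if "t \<in> I" for t
  proof -
    have "(A has_vector_derivative k t) (at t)"
      using A[of t] at_within_interior[of t "{a - 1..a + 2 * pi + 1}"] that by (simp add: I_def)
    hence "(A has_real_derivative k t) (at t)"
      by (simp add: has_real_derivative_iff_has_vector_derivative)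
    thus ?thesis unfolding \<eta>_def by (auto intro!: derivative_eq_intros)
  qed
  have lift: "g (cis t) = cis (\<eta> t)" if t: "t \<in> I" for t
  proof -
    define w where "w t = g (cis t) * cis (- \<eta> t)" for t
    have dw: "(w has_vector_derivative 0) (at t within I)" if "t \<in> I" for t
    proof -
      have 1: "((\<lambda>t. g (cis t)) has_vector_derivative \<i> * of_real (k t) * g (cis t)) (at t)"
      proof -
        have "(cis has_vector_derivative \<i> * cis t) (at t)"
          using has_vector_derivative_cis_compose[OF DERIV_ident] by simp
        from field_vector_diff_chain_at[OF this gd] show ?thesis
          using kg[of t] by (simp add: o_def mult_ac)
      qed
      have 2: "((\<lambda>t. cis (- \<eta> t)) has_vector_derivative - \<i> * of_real (k t) * cis (- \<eta> t)) (at t)"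
        using has_vector_derivative_cis_compose[OF DERIV_minus[OF d\<eta>[OF that]]] by simp
      have "(w has_vector_derivative g (cis t) * (- \<i> * of_real (k t) * cis (- \<eta> t)) + \<i> * of_real (k t) * g (cis t) * cis (- \<eta> t)) (at t)"
        unfolding w_def[abs_def] by (rule has_vector_derivative_mult[OF 1 2])
      thus ?thesis by (simp add: mult_ac has_vector_derivative_at_within)
    qed
    have "convex I" by (simp add: I_def)
    from has_vector_derivative_zero_constant[OF this dw] obtain c where c: "\<And>t. t \<in> I \<Longrightarrow> w t = c" by blast
    have "a \<in> I" unfolding I_def greaterThanLessThan_iff using pi_gt_zero by linarith
    have "w t = w a" using c[OF t] c[OF \<open>a \<in> I\<close>] by simp
    also have "\<dots> = 1"
    proof -
      have "g (cis a) = cis a" using g(3)[OF cb(1)[of a]] z1(2) unfolding a by simp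
      thus ?thesis by (simp add: w_def \<eta>_def cis_mult)
    qed
    finally have "g (cis t) * (cis (- \<eta> t) * cis (\<eta> t)) = cis (\<eta> t)"
      by (simp add: w_def mult.assoc[symmetric])
    thus ?thesis by (simp add: cis_mult)
  qed
  have sub: "{a..a + 2 * pi} \<subseteq> I" by (auto simp: I_def)
  have mono: "\<eta> s \<le> \<eta> t" if "a \<le> s" "s \<le> t" "t \<le> a + 2 * pi" for s t
    by (rule DERIV_nonneg_imp_nondecreasing[OF that(2)]) (use that sub d\<eta> k0 in \<open>force simp: I_def\<close>)
  have \<eta>a: "\<eta> a = a" by (simp add: \<eta>_def)
  have "cis (\<eta> (a + 2 * pi)) = cis a"
    using lift[of "a + 2 * pi"] lift[of a] sub \<eta>a pi_gt_zero
      by (simp add: cis_mult[symmetric] subset_iff)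
  hence "cis (\<eta> (a + 2 * pi) - a) = 1" by (simp add: cis_divide[symmetric])
  then obtain n :: int where n: "\<eta> (a + 2 * pi) - a = 2 * pi * of_int n" by (rule cis_eq_1_imp)
  have "0 \<le> 2 * pi * of_int n" using mono[of a "a + 2 * pi"] \<eta>a n by simp
  hence "0 \<le> n" by (simp add: zero_le_mult_iff) (use pi_gt_zero in linarith)
  moreover have "n \<noteq> 0"
  proof
    assume "n = 0"
    hence end_eq: "\<eta> (a + 2 * pi) = a" using n by simp
    have const: "\<phi> z = z1" if z: "norm z = 1" for z
    proof -
      define s where "s = (if a \<le> Arg z then Arg z else Arg z + 2 * pi)"
      have s: "a \<le> s" "s \<le> a + 2 * pi"
        using Arg_bounded[of z] Arg_bounded[of z1] by (auto simp: s_def a_def)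
      have cs: "cis s = z" using cis_Arg_unimodular[OF z] by (auto simp: s_def cis_mult[symmetric])
      have "\<eta> s = a" using mono[of a s] mono[of s "a + 2 * pi"] s end_eq \<eta>a by simp
      hence "g (cis s) = cis a" using lift[of s] s sub by (simp add: subset_iff)
      thus ?thesis using g(3)[OF cb(1)[of s]] a cs by simp
    qed
    note sm = analytic_on_disc_smooth[OF \<phi>(1)]
    have "norm (\<phi> 0 - z1) \<le> 0"
    proof (rule maximum_modulus_frontier[of "\<lambda>z. \<phi> z - z1" "cball 0 1"])
      show "(\<lambda>z. \<phi> z - z1) holomorphic_on interior (cball 0 1)"
        using disc_smooth_holomorphic[OF sm, of 0] by (auto intro!: holomorphic_intros)
      show "continuous_on (closure (cball 0 1)) (\<lambda>z. \<phi> z - z1)"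
        using disc_smooth_continuous[OF sm, of 0] by (auto intro!: continuous_intros)
    qed (use const in auto)
    hence "\<phi> 0 = z1" by simp
    moreover have "\<phi> 0 \<in> ball 0 1" using \<phi>(3) by (rule subsetD) simp
    ultimately show False using z1(1) by simp
  qed
  ultimately have n1: "1 \<le> n" by simp
  have "2 * pi * 1 \<le> 2 * pi * real_of_int n" using n1 by (intro mult_left_mono) simp_all
  hence end_ge: "a + 2 * pi \<le> \<eta> (a + 2 * pi)" using n by linarith
  have ka: "k a < 1"
  proof -
    have "deriv g (cis a) = disc_deriv \<phi> z1" using disc_deriv_eqI[OF \<phi>d[of a] cb(1)] unfolding a by simp
    moreover have "deriv g (cis a) = of_real (k a)"
      using kc[of a] g1[of a] g(3)[OF cb(1)[of a]] a z1(2) by (simp add: mult.assoc)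
    ultimately show ?thesis using z1(3) by (metis Re_complex_of_real)
  qed
  have kend: "k (a + 2 * pi) = k a" by (simp add: k_def cis_mult[symmetric])
  define F where "F t = \<eta> t - t" for t
  have dF: "(F has_real_derivative k t - 1) (at t)" if "t \<in> I" for t
    unfolding F_def by (intro DERIV_diff d\<eta> that DERIV_ident)
  have aI: "a \<in> I" "a + 2 * pi \<in> I" using sub pi_gt_zero by auto
  obtain d1 where d1: "0 < d1" "\<And>h. 0 < h \<Longrightarrow> h < d1 \<Longrightarrow> F (a + h) < F a"
    using DERIV_neg_dec_right[OF dF[OF aI(1)]] ka by auto
  obtain d2 where d2: "0 < d2" "\<And>h. 0 < h \<Longrightarrow> h < d2 \<Longrightarrow> F (a + 2 * pi) < F (a + 2 * pi - h)"
    using DERIV_neg_dec_left[OF dF[OF aI(2)]] ka kend by auto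
  define h where "h = min (min d1 d2) pi / 2"
  have h: "0 < h" "h < d1" "h < d2" "h < pi" using d1(1) d2(1) pi_gt_zero by (auto simp: h_def min_def)
  have "F (a + h) \<le> 0" using d1(2)[OF h(1,2)] \<eta>a by (simp add: F_def)
  moreover have "0 \<le> F (a + 2 * pi - h)" using d2(2)[OF h(1,3)] end_ge by (simp add: F_def)
  moreover have "continuous_on {a + h..a + 2 * pi - h} F"
    using dF h by (intro continuous_at_imp_continuous_on ballI DERIV_isCont[OF dF]) (auto simp: I_def)
  ultimately obtain t where t: "a + h \<le> t" "t \<le> a + 2 * pi - h" "F t = 0"
    using IVT'[of F "a + h" 0 "a + 2 * pi - h"] h by auto
  have tI: "t \<in> I" using t h by (auto simp: I_def)
  have "\<phi> (cis t) = cis t" using lift[OF tI] t(3) g(3)[OF cb(1)[of t]] by (simp add: F_def)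
  moreover have "cis t \<noteq> z1"
  proof
    assume "cis t = z1"
    hence "cis (t - a) = z1 / z1" using a by (simp only: cis_divide[symmetric])
    hence "cis (t - a) = 1" using z1(1) by auto
    then obtain m :: int where m: "t - a = 2 * pi * of_int m" by (rule cis_eq_1_imp)
    have "0 < 2 * pi * of_int m" "2 * pi * of_int m < 2 * pi * 1" using t h m by linarith+
    have "0 < (of_int m :: real)" by (rule zero_less_mult_pos[OF \<open>0 < 2 * pi * of_int m\<close>]) simp
    moreover have "(of_int m :: real) < 1"
      by (rule mult_left_less_imp_less[OF \<open>2 * pi * of_int m < 2 * pi * 1\<close>]) simp
    ultimately show False by simp
  qed
  ultimately show thesis using that[of "cis t"] by simp
qed

section \<open>Uniform convergence of the iterates\<close>

text \<open>By Schwarz--Pick the pseudohyperbolic distance of two orbits stays bounded away from one, so if one orbit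
  tends to a boundary point, the other one follows.\<close>

lemma interior_orbits_converge_together:
  assumes hol: "\<phi> holomorphic_on ball 0 1" and self: "\<phi> ` ball 0 1 \<subseteq> ball 0 1"
    and a: "a \<in> ball 0 1" "(\<lambda>n. (\<phi> ^^ n) a) \<longlonglongrightarrow> p" "norm p = 1" and z: "z \<in> ball 0 1"
  shows "(\<lambda>n. (\<phi> ^^ n) z) \<longlonglongrightarrow> p"
proof -
  define D where "D = norm (1 - cnj a * z)"
  have a1: "norm a < 1" and z1: "norm z < 1" using a(1) z by simp_all
  have D: "0 < D" using one_minus_cnj_mult_neq_0[of a z] a1 z1 by (simp add: D_def)
  define \<rho> where "\<rho> = norm (z - a) / D"
  have "(norm (z - a))\<^sup>2 < D\<^sup>2"
  proof -
    have "0 < (1 - (norm a)\<^sup>2) * (1 - (norm z)\<^sup>2)"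
      using a1 z1 by (intro mult_pos_pos) (simp_all add: power_less_one_iff abs_square_less_1)
    thus ?thesis using norm_one_minus_cnj_mult[of a z] by (simp add: D_def)
  qed
  hence "norm (z - a) < D" by (rule power_less_imp_less_base) (use D in simp)
  hence \<rho>: "0 \<le> \<rho>" "\<rho> < 1" using D by (simp_all add: \<rho>_def)
  have bound: "norm ((\<phi> ^^ n) z - (\<phi> ^^ n) a) \<le> \<rho> / (1 - \<rho>) * (1 - (norm ((\<phi> ^^ n) a))\<^sup>2)" for n
  proof -
    define u v where "u = (\<phi> ^^ n) a" and "v = (\<phi> ^^ n) z"
    have u: "norm u < 1" using funpow_ball[OF self a(1), of n] by (simp add: u_def)
    have im: "(\<phi> ^^ n) ` ball 0 1 \<subseteq> ball 0 1" using funpow_ball[OF self] by blast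
    have "norm (v - u) * D \<le> norm (z - a) * norm (1 - cnj u * v)"
      unfolding u_def v_def D_def by (rule Schwarz_Pick[OF holomorphic_on_funpow[OF hol self] im a1 z1])
    hence 1: "norm (v - u) \<le> \<rho> * norm (1 - cnj u * v)" using D by (simp add: \<rho>_def field_simps)
    have "1 - cnj u * v = of_real (1 - (norm u)\<^sup>2) - cnj u * (v - u)"
      using complex_norm_square[of u] by (simp add: algebra_simps)
    hence "norm (1 - cnj u * v) \<le> norm (complex_of_real (1 - (norm u)\<^sup>2)) + norm (cnj u * (v - u))"
      by (simp only: norm_triangle_ineq4)
    also have "norm (complex_of_real (1 - (norm u)\<^sup>2)) = 1 - (norm u)\<^sup>2"
      unfolding norm_of_real using u by (simp add: power_le_one)
    also have "norm (cnj u * (v - u)) \<le> norm (v - u)" using u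
      by (simp add: norm_mult mult_left_le_one_le)
    finally have "\<rho> * norm (1 - cnj u * v) \<le> \<rho> * ((1 - (norm u)\<^sup>2) + norm (v - u))"
      using \<rho> by (intro mult_left_mono) auto
    with 1 have "norm (v - u) * (1 - \<rho>) \<le> \<rho> * (1 - (norm u)\<^sup>2)" by (simp add: algebra_simps)
    thus ?thesis using \<rho> by (simp add: u_def v_def pos_le_divide_eq)
  qed
  have "(\<lambda>n. \<rho> / (1 - \<rho>) * (1 - (norm ((\<phi> ^^ n) a))\<^sup>2)) \<longlonglongrightarrow> \<rho> / (1 - \<rho>) * (1 - (norm p)\<^sup>2)"
    by (intro tendsto_intros a(2))
  hence lim0: "(\<lambda>n. \<rho> / (1 - \<rho>) * (1 - (norm ((\<phi> ^^ n) a))\<^sup>2)) \<longlonglongrightarrow> 0" by (simp add: a(3))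
  have "(\<lambda>n. (\<phi> ^^ n) z - (\<phi> ^^ n) a) \<longlonglongrightarrow> 0"
    by (rule Lim_null_comparison[OF always_eventually[OF allI[OF bound]] lim0])
  from tendsto_add[OF this a(2)] show ?thesis by simp
qed

text \<open>If every orbit reaches the region \<open>V\<close> near \<open>p\<close> where \<open>|\<phi>'| \<le> q < 1\<close>, then by compactness all orbits have entered
  \<open>V\<close> after a common time \<open>n0\<close>, since \<open>\<phi>\<close> maps \<open>V\<close> to itself; from then on the chain rule contributes a factor
  \<open>q\<close> per step.\<close>

lemma attracting_fixpoint_uniform:
  assumes \<phi>: "analytic_on_disc \<phi>" "\<phi> ` cball 0 1 \<subseteq> cball 0 1"
    and p: "p \<in> cball 0 1" "\<phi> p = p"
    and V: "V = cball 0 1 \<inter> ball p \<epsilon>" "0 < \<epsilon>"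
    and q: "0 \<le> q" "q < 1" "\<And>z. z \<in> V \<Longrightarrow> norm (disc_deriv \<phi> z) \<le> q"
    and reach: "\<And>z. z \<in> cball 0 1 \<Longrightarrow> \<exists>n. (\<phi> ^^ n) z \<in> V"
  shows "\<forall>\<^sub>F n in sequentially. \<forall>z\<in>cball 0 1. norm (disc_deriv (\<phi> ^^ n) z) \<le> 1 / 2"
proof -
  have an: "analytic_on_disc (\<phi> ^^ n)" and im: "(\<phi> ^^ n) ` cball 0 1 \<subseteq> cball 0 1" for n
    by (rule analytic_on_disc_funpow[OF \<phi>])+
  have itc: "(\<phi> ^^ n) z \<in> cball 0 1" if "z \<in> cball 0 1" for n z by (rule funpow_ball[OF \<phi>(2) that])
  have der: "(f has_field_derivative disc_deriv f z) (at z within cball 0 1)"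
    if "analytic_on_disc f" "z \<in> cball 0 1" for f z
    using disc_smooth_has_field_derivative[OF analytic_on_disc_smooth[OF that(1)] that(2), of 0] by simp
  have cont: "continuous_on (cball 0 1) (\<phi> ^^ n)" for n
    using disc_smooth_continuous[OF analytic_on_disc_smooth[OF an], of 0] by simp
  have pV: "p \<in> V" using p V by simp
  have VV: "\<phi> z \<in> V" if z: "z \<in> V" for z
  proof -
    have conv: "convex V" unfolding V(1) by (intro convex_Int convex_cball convex_ball)
    have "norm (\<phi> z - \<phi> p) \<le> q * norm (z - p)"
    proof (rule field_differentiable_bound[OF conv _ q(3) z pV])
      show "(\<phi> has_field_derivative disc_deriv \<phi> x) (at x within V)" if "x \<in> V" for x
        by (rule DERIV_subset[OF der[OF \<phi>(1)]]) (use that V(1) in auto)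
    qed
    also have "\<dots> \<le> 1 * norm (z - p)" using q by (intro mult_right_mono) auto
    also have "\<dots> < \<epsilon>" using z V(1) by (simp add: dist_norm norm_minus_commute)
    finally have "\<phi> z \<in> ball p \<epsilon>" by (simp add: p(2) dist_norm norm_minus_commute)
    moreover have "\<phi> z \<in> cball 0 1" using \<phi>(2) z V(1) by blast
    ultimately show ?thesis unfolding V(1) by blast
  qed
  have stay: "(\<phi> ^^ n) z \<in> V" if "(\<phi> ^^ m) z \<in> V" "m \<le> n" for m n z
    using that(2) by (induction n rule: dec_induct) (use that(1) VV in auto)
  have "\<exists>n0. \<forall>z\<in>cball 0 1. (\<phi> ^^ n0) z \<in> V"
  proof (rule ccontr)
    assume "\<nexists>n0. \<forall>z\<in>cball 0 1. (\<phi> ^^ n0) z \<in> V"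
    then obtain x where x: "\<And>n. x n \<in> cball 0 1" "\<And>n. (\<phi> ^^ n) (x n) \<notin> V" by metis
    obtain y s where y: "y \<in> cball 0 1" "strict_mono s" "(x \<circ> s) \<longlonglongrightarrow> y"
      using compact_cball x(1) unfolding compact_def by metis
    obtain m where m: "(\<phi> ^^ m) y \<in> V" using reach[OF y(1)] by blast
    have "(\<lambda>n. (\<phi> ^^ m) (x (s n))) \<longlonglongrightarrow> (\<phi> ^^ m) y"
      by (rule continuous_on_tendsto_compose[OF cont _ y(1)]) (use y(3) x(1) in \<open>simp_all add: o_def\<close>)
    hence "\<forall>\<^sub>F n in sequentially. (\<phi> ^^ m) (x (s n)) \<in> ball p \<epsilon>"
      by (rule topological_tendstoD) (use m V(1) in auto)
    moreover have "\<forall>\<^sub>F n in sequentially. m \<le> n" by (rule eventually_ge_at_top)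
    ultimately have "\<forall>\<^sub>F n in sequentially. False"
    proof eventually_elim
      case (elim n)
      have "(\<phi> ^^ m) (x (s n)) \<in> V" using elim(1) itc[OF x(1)] unfolding V(1) by blast
      moreover have "m \<le> s n" using elim(2) seq_suble[OF y(2), of n] by simp
      ultimately show ?case using stay x(2) by blast
    qed
    thus False by simp
  qed
  then obtain n0 where n0: "\<And>z. z \<in> cball 0 1 \<Longrightarrow> (\<phi> ^^ n0) z \<in> V" by blast
  have chain: "disc_deriv (\<phi> ^^ Suc n) z = disc_deriv \<phi> ((\<phi> ^^ n) z) * disc_deriv (\<phi> ^^ n) z"
    if z: "z \<in> cball 0 1" for n z
  proof -
    have "(\<phi> has_field_derivative disc_deriv \<phi> ((\<phi> ^^ n) z)) (at ((\<phi> ^^ n) z) within (\<phi> ^^ n) ` cball 0 1)"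
      by (rule DERIV_subset[OF der[OF \<phi>(1) itc[OF z]] im])
    from DERIV_image_chain[OF this der[OF an z]]
    show ?thesis by (intro disc_deriv_eqI z) (simp only: funpow.simps)
  qed
  define L where "L = disc_sup_norm (disc_deriv (\<phi> ^^ n0))"
  have decay: "norm (disc_deriv (\<phi> ^^ (m + n0)) z) \<le> q ^ m * L" if z: "z \<in> cball 0 1" for m z
  proof (induction m)
    case 0
    show ?case using norm_le_disc_sup_norm[OF analytic_on_disc_smooth[OF an[of n0]] z, of 1]
      by (simp add: L_def)
  next
    case (Suc m)
    have "(\<phi> ^^ (m + n0)) z \<in> V" by (rule stay[OF n0[OF z]]) simp
    hence "norm (disc_deriv \<phi> ((\<phi> ^^ (m + n0)) z)) * norm (disc_deriv (\<phi> ^^ (m + n0)) z) \<le> q * (q ^ m * L)"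
      using Suc q by (intro mult_mono) auto
    thus ?case unfolding add_Suc chain[OF z] norm_mult power_Suc mult.assoc .
  qed
  have "(\<lambda>m. q ^ m * L) \<longlonglongrightarrow> 0 * L"
    using q by (intro tendsto_mult_right LIMSEQ_power_zero) auto
  hence "\<forall>\<^sub>F m in sequentially. q ^ m * L < 1 / 2" by (rule order_tendstoD) simp
  then obtain m0 where m0: "\<And>m. m0 \<le> m \<Longrightarrow> q ^ m * L < 1 / 2" unfolding eventually_sequentially by blast
  show ?thesis unfolding eventually_sequentially
  proof (intro exI[of _ "m0 + n0"] allI impI ballI)
    fix n and z :: complex assume "m0 + n0 \<le> n" and z: "z \<in> cball 0 1"
    hence "n = (n - n0) + n0" "m0 \<le> n - n0" by simp_all
    thus "norm (disc_deriv (\<phi> ^^ n) z) \<le> 1 / 2"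
      using decay[OF z, of "n - n0"] m0[of "n - n0"] by simp
  qed
qed

lemma attracting_boundary_fixpoint_eventually_contracts:
  assumes \<phi>: "analytic_on_disc \<phi>" "\<phi> ` cball 0 1 \<subseteq> cball 0 1" "\<phi> ` ball 0 1 \<subseteq> ball 0 1"
    and p: "norm p = 1" "\<phi> p = p" "Re (disc_deriv \<phi> p) < 1"
    and uniq: "\<And>n z. 0 < n \<Longrightarrow> norm z = 1 \<Longrightarrow> (\<phi> ^^ n) z = z \<Longrightarrow> z = p"
  shows "\<forall>\<^sub>F n in sequentially. \<forall>z\<in>cball 0 1. norm (disc_deriv (\<phi> ^^ n) z) \<le> 1 / 2"
proof -
  note s = analytic_on_disc_smooth[OF \<phi>(1)]
  have hol: "\<phi> holomorphic_on ball 0 1" using disc_smooth_holomorphic[OF s, of 0] by simp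
  have pc: "p \<in> cball 0 1" using p(1) by simp
  have der: "(\<phi> has_field_derivative disc_deriv \<phi> z) (at z within cball 0 1)" if "z \<in> cball 0 1" for z
    using disc_smooth_has_field_derivative[OF s that, of 0] by simp
  have "Im (disc_deriv \<phi> p * p * cnj (\<phi> p)) = 0" "0 \<le> Re (disc_deriv \<phi> p * p * cnj (\<phi> p))"
    by (rule boundary_derivative_real_nonneg[OF \<phi>(2) der[OF pc] p(1)]; simp add: p)+
  hence "Im (disc_deriv \<phi> p) = 0" "0 \<le> Re (disc_deriv \<phi> p)"
    unfolding p(2) mult.assoc unimodular_mult_cnj[OF p(1)] by simp_all
  hence "norm (disc_deriv \<phi> p) < 1" using p(3) by (simp add: cmod_eq_Re)
  then obtain q where q: "norm (disc_deriv \<phi> p) < q" "q < 1" using dense by blast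
  have "continuous_on (cball 0 1) (disc_deriv \<phi>)" using disc_smooth_continuous[OF s, of 1] by simp
  then obtain \<epsilon> where \<epsilon>: "0 < \<epsilon>" "\<And>z. z \<in> cball 0 1 \<Longrightarrow> dist z p < \<epsilon> \<Longrightarrow>
      dist (disc_deriv \<phi> z) (disc_deriv \<phi> p) < q - norm (disc_deriv \<phi> p)"
    unfolding continuous_on_iff using pc q(1) by (metis diff_gt_0_iff_gt)
  define V where "V = cball 0 1 \<inter> ball p \<epsilon>"
  have q0: "0 \<le> q" using q(1) norm_ge_zero[of "disc_deriv \<phi> p"] by linarith
  have dV: "norm (disc_deriv \<phi> z) \<le> q" if "z \<in> V" for z
  proof -
    have "norm (disc_deriv \<phi> z - disc_deriv \<phi> p) < q - norm (disc_deriv \<phi> p)"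
      using \<epsilon>(2)[of z] that by (simp add: V_def dist_norm norm_minus_commute)
    thus ?thesis using norm_triangle_sub[of "disc_deriv \<phi> z" "disc_deriv \<phi> p"] by linarith
  qed
  have convV: "convex V" unfolding V_def by (intro convex_Int convex_cball convex_ball)
  have pV: "p \<in> V" using pc \<epsilon>(1) by (simp add: V_def)
  have contr: "norm (\<phi> z - p) \<le> q * norm (z - p)" if z: "z \<in> V" for z
  proof -
    have "norm (\<phi> z - \<phi> p) \<le> q * norm (z - p)"
    proof (rule field_differentiable_bound[OF convV _ dV z pV])
      show "(\<phi> has_field_derivative disc_deriv \<phi> x) (at x within V)" if "x \<in> V" for x
        by (rule DERIV_subset[OF der]) (use that in \<open>auto simp: V_def\<close>)
    qed
    thus ?thesis by (simp add: p(2))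
  qed
  have interior: "\<exists>n. (\<phi> ^^ n) z \<in> V" if z: "z \<in> ball 0 1" for z
  proof -
    define r where "r = max 0 (1 - \<epsilon> / 2)"
    define a where "a = of_real r * p"
    have r: "0 \<le> r" "r < 1" "1 - r < \<epsilon>" using \<epsilon>(1) by (auto simp: r_def)
    have a: "a \<in> ball 0 1" using r p(1) by (simp add: a_def norm_mult)
    have "p - a = of_real (1 - r) * p" by (simp add: a_def algebra_simps)
    hence "norm (p - a) = 1 - r" using r p(1) by (simp only: norm_mult norm_of_real) simp
    hence aV: "a \<in> V" using a r by (simp add: V_def dist_norm)
    have orb: "(\<phi> ^^ n) a \<in> V \<and> norm ((\<phi> ^^ n) a - p) \<le> q ^ n * norm (a - p)" for n
    proof (induction n)
      case (Suc n)
      have 1: "norm (\<phi> ((\<phi> ^^ n) a) - p) \<le> q * norm ((\<phi> ^^ n) a - p)" using contr Suc by blast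
      have "q * norm ((\<phi> ^^ n) a - p) \<le> 1 * norm ((\<phi> ^^ n) a - p)" using q(2)
        by (intro mult_right_mono) auto
      moreover have "norm ((\<phi> ^^ n) a - p) < \<epsilon>" using Suc
        by (simp add: V_def dist_norm norm_minus_commute)
      moreover have "\<phi> ((\<phi> ^^ n) a) \<in> cball 0 1" using Suc \<phi>(2) unfolding V_def by blast
      ultimately have "\<phi> ((\<phi> ^^ n) a) \<in> V" using 1 by (simp add: V_def dist_norm norm_minus_commute)
      moreover have "q * norm ((\<phi> ^^ n) a - p) \<le> q * (q ^ n * norm (a - p))"
        using Suc q0 by (intro mult_left_mono) auto
      ultimately show ?case using 1 by simp
    qed (use aV in simp)
    have "(\<lambda>n. q ^ n * norm (a - p)) \<longlonglongrightarrow> 0 * norm (a - p)"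
      using q0 q(2) by (intro tendsto_mult_right LIMSEQ_power_zero) auto
    hence q_lim: "(\<lambda>n. q ^ n * norm (a - p)) \<longlonglongrightarrow> 0" by simp
    have "(\<lambda>n. (\<phi> ^^ n) a - p) \<longlonglongrightarrow> 0"
      by (rule Lim_null_comparison[OF _ q_lim]) (use orb in auto)
    hence "(\<lambda>n. (\<phi> ^^ n) a) \<longlonglongrightarrow> p" by (simp add: LIM_zero_iff)
    from interior_orbits_converge_together[OF hol \<phi>(3) a this p(1) z]
    have "\<forall>\<^sub>F n in sequentially. (\<phi> ^^ n) z \<in> ball p \<epsilon>"
      by (rule topological_tendstoD) (use \<epsilon>(1) in auto)
    then obtain n where "(\<phi> ^^ n) z \<in> ball p \<epsilon>" unfolding eventually_sequentially by blast
    moreover have "(\<phi> ^^ n) z \<in> cball 0 1" using funpow_ball[OF \<phi>(3) z, of n] by simp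
    ultimately show ?thesis unfolding V_def by blast
  qed
  have fin: "finite {z. norm z = 1 \<and> norm (\<phi> z) = 1}"
  proof (rule unimodular_finite_or_all[OF \<phi>(1)])
    assume "\<And>z. norm z = 1 \<Longrightarrow> norm (\<phi> z) = 1"
    from inner_attracting_second_fixpoint[OF \<phi> this p] obtain z2
      where "norm z2 = 1" "\<phi> z2 = z2" "z2 \<noteq> p" by blast
    with uniq[of 1 z2] show ?thesis by simp
  qed
  have reach: "\<exists>n. (\<phi> ^^ n) z \<in> V" if z: "z \<in> cball 0 1" for z
  proof (cases "\<exists>m. (\<phi> ^^ m) z \<in> ball 0 1")
    case True
    then obtain m n where "(\<phi> ^^ n) ((\<phi> ^^ m) z) \<in> V" using interior by blast
    hence "(\<phi> ^^ (n + m)) z \<in> V" by (simp add: funpow_add)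
    thus ?thesis by blast
  next
    case False
    have unit: "norm ((\<phi> ^^ n) z) = 1" for n
    proof -
      have "norm ((\<phi> ^^ n) z) \<le> 1" using funpow_ball[OF \<phi>(2) z, of n] unfolding mem_cball_0 .
      moreover have "\<not> norm ((\<phi> ^^ n) z) < 1" using False unfolding mem_ball_0 by blast
      ultimately show ?thesis by simp
    qed
    \<comment> \<open>The orbit lives in a finite set, so it is eventually periodic; its periodic points are fixed by an iterate.\<close>
    have "range (\<lambda>n. (\<phi> ^^ n) z) \<subseteq> {z. norm z = 1 \<and> norm (\<phi> z) = 1}"
      using unit unit[of "Suc _"] by auto
    hence "finite (range (\<lambda>n. (\<phi> ^^ n) z))" using fin by (rule finite_subset)
    hence "\<not> inj (\<lambda>n. (\<phi> ^^ n) z)" using finite_imageD infinite_UNIV_nat by blast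
    then obtain i j where ij: "(\<phi> ^^ i) z = (\<phi> ^^ j) z" "i < j"
      unfolding inj_def by (metis linorder_neqE_nat)
    have "(\<phi> ^^ (j - i)) ((\<phi> ^^ i) z) = (\<phi> ^^ (j - i + i)) z" by (simp only: funpow_add o_apply)
    also have "\<dots> = (\<phi> ^^ i) z" using ij by simp
    finally have "(\<phi> ^^ i) z = p" using uniq[of "j - i" "(\<phi> ^^ i) z"] ij(2) unit by simp
    thus ?thesis using pV by metis
  qed
  show ?thesis
    by (rule attracting_fixpoint_uniform[OF \<phi>(1,2) pc p(2) V_def \<epsilon>(1) q0 q(2) dV reach])
qed

section \<open>Boundary fixed points and endomorphisms\<close>

theorem theorem9:
  fixes M :: "nat \<Rightarrow> real" and \<phi> :: "complex \<Rightarrow> complex"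
  assumes "weight_sequence M" and "nonanalytic M"
    and "analytic_on_disc \<phi>"
    and "\<phi> \<in> disc_algebra M"
    and "\<phi> ` cball 0 1 \<subseteq> cball 0 1"
    and "\<forall>z\<in>cball 0 1. \<phi> z = z \<longrightarrow> z \<in> cball 0 1 - ball 0 1"
  shows "(multiple_boundary_fixpoints \<phi> \<or> (\<exists>N>0. multiple_boundary_fixpoints (\<phi> ^^ N))
            \<longrightarrow> \<not> induces_endomorphism M \<phi>) \<and>
         (\<forall>z\<^sub>1. \<not> (\<exists>N>0. multiple_boundary_fixpoints (\<phi> ^^ N)) \<and>
            boundary_fixpoints \<phi> = {z\<^sub>1} \<and> Re (disc_deriv \<phi> z\<^sub>1) < 1
            \<longrightarrow> (\<forall>\<^sub>F N in sequentially. induces_endomorphism M (\<phi> ^^ N)))"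
proof (intro conjI impI allI)
  note M = assms(1,2) and \<phi> = assms(3,5)
  have nofix: "\<phi> z \<noteq> z" if "z \<in> ball 0 1" for z
    using assms(6) that by (metis DiffE ball_subset_cball subsetD)
  assume "multiple_boundary_fixpoints \<phi> \<or> (\<exists>N>0. multiple_boundary_fixpoints (\<phi> ^^ N))"
  moreover have "\<phi> ^^ 1 = \<phi>" by auto
  ultimately obtain N where N: "0 < N" "multiple_boundary_fixpoints (\<phi> ^^ N)" by (metis zero_less_one)
  show "\<not> induces_endomorphism M \<phi>"
    by (rule multiple_boundary_fixpoints_no_endomorphism[OF M \<phi> nofix N])
next
  note M = assms(1,2) and \<phi> = assms(3,5)
  fix p
  assume hyp: "\<not> (\<exists>N>0. multiple_boundary_fixpoints (\<phi> ^^ N)) \<and> boundary_fixpoints \<phi> = {p} \<and> Re (disc_deriv \<phi> p) < 1"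
  hence single: "\<not> multiple_boundary_fixpoints (\<phi> ^^ N)" if "0 < N" for N using that by blast
  have "p \<in> boundary_fixpoints \<phi>" using hyp by simp
  hence p: "norm p = 1" "\<phi> p = p" by (simp_all add: boundary_fixpoints_def)
  have dp: "Re (disc_deriv \<phi> p) < 1" using hyp by simp
  show "\<forall>\<^sub>F N in sequentially. induces_endomorphism M (\<phi> ^^ N)"
  proof (rule analytic_self_map_cases[OF \<phi>])
    assume inner: "\<phi> ` ball 0 1 \<subseteq> ball 0 1"
    have uniq: "z = p" if n: "0 < n" and z: "norm z = 1" "(\<phi> ^^ n) z = z" for n z
    proof -
      have "(\<phi> ^^ n) p = p" by (induction n) (simp_all add: p)
      hence "z \<in> boundary_fixpoints (\<phi> ^^ n)" "p \<in> boundary_fixpoints (\<phi> ^^ n)"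
        using z p(1) by (auto simp: boundary_fixpoints_def)
      thus ?thesis using single[OF n] unfolding multiple_boundary_fixpoints_def by blast
    qed
    have "\<forall>\<^sub>F n in sequentially. \<forall>z\<in>cball 0 1. norm (disc_deriv (\<phi> ^^ n) z) \<le> 1 / 2"
      by (rule attracting_boundary_fixpoint_eventually_contracts[OF \<phi> inner p dp uniq])
    thus ?thesis
    proof eventually_elim
      case (elim N)
      have "(\<phi> ^^ N) ` ball 0 1 \<subseteq> ball 0 1" using funpow_ball[OF inner] by blast
      from contraction_induces_endomorphism[OF M analytic_on_disc_funpow[OF \<phi>] this, of "1 / 2"] elim
      show ?case by simp
    qed
  next
    fix c assume c: "\<And>z. z \<in> cball 0 1 \<Longrightarrow> \<phi> z = c"
    have "induces_endomorphism M (\<phi> ^^ N)" if N: "0 < N" for N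
      unfolding induces_endomorphism_def
    proof
      fix f assume "f \<in> disc_algebra M"
      obtain m where m: "N = Suc m" using N by (cases N) auto
      have "(f \<circ> \<phi> ^^ N) z = f c" if "z \<in> cball 0 1" for z
        using c[OF funpow_ball[OF \<phi>(2) that, of m]] by (simp add: m)
      hence "analytic_on_disc (f \<circ> \<phi> ^^ N)"
        unfolding analytic_on_disc_def by (intro exI[of _ UNIV] exI[of _ "\<lambda>_. f c"]) auto
      thus "f \<circ> \<phi> ^^ N \<in> disc_algebra M" by (rule analytic_on_disc_imp_disc_algebra[OF M])
    qed
    thus ?thesis unfolding eventually_sequentially by (metis Suc_le_lessD)
  qed
qed

end
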